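(* Let $C: f=0$ be a nearly free curve of degree $d\geq 3$ in $\mathbb{P}^2$ with exponents $(d_1,d_2)$, let $T=3d-6$, and set $s=\sigma(C)-(d-2)$. Then one of the following two cases holds. (1) $s=0$ and the minimal graded free resolution of the graded $S$-module $S/I_f$ has the form $$0 \to S(-T-1+\sigma(C)) \to S(1-d) \oplus S(-\sigma(C)) \to S;$$ (2) $1 \leq s \leq \lfloor d/2 \rfloor -1$ and the minimal graded free resolution of the graded $S$-module $S/I_f$ has the form $$0 \to S(-\sigma(C)-1)^2\oplus S(-T-1+\sigma(C)) \to S(1-d)^3 \oplus S(-\sigma(C)) \to S.$$
   Context: Let $S=\mathbb{C}[x,y,z]$ with the standard grading, and let $C:f=0$ be a reduced curve of degree $d$ in the complex projective plane $\mathbb{P}^2$, where $f\in S$ is homogeneous. $J_f=(f_x,f_y,f_z)\subset S$ is the Jacobian ideal of $f$ and $I_f$ is its saturation with respect to the maximal ideal $\mathbf{m}=(x,y,z)$. Put $N(f)=I_f/J_f$, a graded $S$-module, and $n(f)_k=\dim_{\mathbb{C}} N(f)_k$. Define $\nu(C)=\max_j n(f)_j$ and $\sigma(C)=\min\{j : n(f)_j\neq 0\}$. The curve $C$ is nearly free if $\nu(C)=1$; in this case there is a unique pair of integers $d_1\le d_2$, called the exponents of $C$, with $d_1+d_2=d$, such that the minimal graded free resolution of $S/J_f$ has the form $$0 \to S(-d-d_2) \to S(-d-d_1+1) \oplus S(-d-d_2+1)^2 \to S(-d+1)^3 \to S,$$ where the last map is $(f_x,f_y,f_z)$. In resolutions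 of a quotient $S/I$ the final map $S\to S/I$ is omitted. *)

theory Defs
  imports
    "HOL-Library.Poly_Mapping"
    "HOL-Library.Numeral_Type"
    "HOL-Library.Set_Algebras"
    "HOL-Library.Extended_Nat"
    "HOL-Computational_Algebra.Squarefree"
    "Jordan_Normal_Form.Matrix_Kernel"
begin

section \<open>The graded polynomial ring in three variables\<close>

text \<open>
  A monomial is its exponent vector, indexed by the three-element type \<open>3\<close>, whose elements
  \<open>0\<close>, \<open>1\<close>, \<open>2\<close> stand for the variables \<open>x\<close>, \<open>y\<close>, \<open>z\<close>. The ring structure on
  finitely supported functions from monomials to coefficients (convolution product) is that of
  \<^theory>\<open>HOL-Library.Poly_Mapping\<close>.
\<close>

type_synonym mon = "3 \<Rightarrow>\<^sub>0 nat"
type_synonym S = "mon \<Rightarrow>\<^sub>0 complex"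

definition Cst :: "complex \<Rightarrow> S" where
  "Cst c = Poly_Mapping.single 0 c"

definition Var :: "3 \<Rightarrow> S" where
  "Var i = Poly_Mapping.single (Poly_Mapping.single i 1) 1"

definition mdeg :: "mon \<Rightarrow> nat" where
  "mdeg t = (\<Sum>i\<in>UNIV. Poly_Mapping.lookup t i)"

text \<open>Degrees are integers because of twists; only \<open>0\<close> is homogeneous of negative degree.\<close>

definition homogeneous :: "int \<Rightarrow> S \<Rightarrow> bool" where
  "homogeneous k p \<longleftrightarrow> (\<forall>t\<in>Poly_Mapping.keys p. int (mdeg t) = k)"

text \<open>
  The truncated subtraction in the exponent is harmless: if \<open>t\<close> does not involve the
  \<open>i\<close>-th variable, its coefficient is multiplied by \<open>0\<close>.
\<close>

definition pdiff :: "3 \<Rightarrow> S \<Rightarrow> S" where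
  "pdiff i p = (\<Sum>t\<in>Poly_Mapping.keys p.
     Poly_Mapping.single (t - Poly_Mapping.single i 1)
       (of_nat (Poly_Mapping.lookup t i) * Poly_Mapping.lookup p t))"

section \<open>Ideals, saturation, Jacobian ideal\<close>

definition ideal_gen :: "S set \<Rightarrow> S set" where
  "ideal_gen B = Modules.module.span (*) B"

primrec ideal_pow :: "S set \<Rightarrow> nat \<Rightarrow> S set" where
  "ideal_pow I 0 = UNIV"
| "ideal_pow I (Suc k) = ideal_gen {a * b | a b. a \<in> I \<and> b \<in> ideal_pow I k}"

definition irrelevant_ideal :: "S set" where
  "irrelevant_ideal = ideal_gen (range Var)"

text \<open>The saturation is the union over \<open>k\<close> of the ideal quotients of \<open>J\<close> by the
  \<open>k\<close>-th power of the irrelevant ideal.\<close>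

definition saturation :: "S set \<Rightarrow> S set" where
  "saturation J = {p. \<exists>k. \<forall>q\<in>ideal_pow irrelevant_ideal k. q * p \<in> J}"

definition jacobian_ideal :: "S \<Rightarrow> S set" where
  "jacobian_ideal f = ideal_gen {pdiff 0 f, pdiff 1 f, pdiff 2 f}"

definition saturated_jacobian_ideal :: "S \<Rightarrow> S set" where
  "saturated_jacobian_ideal f = saturation (jacobian_ideal f)"

section \<open>The module \<open>N(f)\<close> and its numerical invariants\<close>

text \<open>
  The degree \<open>k\<close> piece of \<open>I / J\<close>, as a complex vector space: its elements are the cosets
  \<open>p + J\<close> of the homogeneous \<open>p \<in> I\<close> of degree \<open>k\<close>. The ring multiplication fields
  of the record play no role. In \<open>smult\<close>, adding \<open>J\<close> again only matters for the
  scalar \<open>0\<close>.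
\<close>

definition quotient_piece :: "S set \<Rightarrow> S set \<Rightarrow> nat \<Rightarrow> (complex, S set) module" where
  "quotient_piece I J k =
     \<lparr> carrier = (\<lambda>p. p +o J) ` {p \<in> I. homogeneous (int k) p},
       monoid.mult = (\<lambda>_ _. undefined), one = undefined,
       zero = J, add = (+),
       smult = (\<lambda>c A. Cst c *o A + J) \<rparr>"

definition N_piece :: "S \<Rightarrow> nat \<Rightarrow> (complex, S set) module" where
  "N_piece f k = quotient_piece (saturated_jacobian_ideal f) (jacobian_ideal f) k"

definition dim_N :: "S \<Rightarrow> nat \<Rightarrow> nat" where
  "dim_N f k = vectorspace.dim class_ring (N_piece f k)"

text \<open>The supremum is taken in \<^typ>\<open>enat\<close> so that it does not depend on knowing beforehand
  that the values are bounded (\<^const>\<open>Max\<close> of an infinite set is unspecified).\<close>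

definition nu_C :: "S \<Rightarrow> enat" where
  "nu_C f = (SUP j. enat (dim_N f j))"

definition sigma_C :: "S \<Rightarrow> nat" where
  "sigma_C f = (LEAST j. dim_N f j \<noteq> 0)"

section \<open>Minimal graded free resolutions\<close>

text \<open>
  A list \<open>[b\<^sub>1, \<dots>, b\<^sub>r]\<close> of integers stands for the graded free module
  \<open>S(-b\<^sub>1) \<oplus> \<dots> \<oplus> S(-b\<^sub>r)\<close>, whose \<open>j\<close>-th basis vector has degree
  \<open>b\<^sub>j\<close>. Matrices act on column vectors; \<open>graded_map b a A\<close> says that \<open>A\<close> is a
  degree-preserving map from the module of \<open>b\<close> to that of \<open>a\<close>.
\<close>

definition graded_map :: "int list \<Rightarrow> int list \<Rightarrow> S mat \<Rightarrow> bool" where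
  "graded_map b a A \<longleftrightarrow> A \<in> carrier_mat (length a) (length b) \<and>
     (\<forall>i<length a. \<forall>j<length b. homogeneous (b ! j - a ! i) (A $$ (i, j)))"

definition mat_image :: "S mat \<Rightarrow> S vec set" where
  "mat_image A = {A *\<^sub>v v | v. v \<in> carrier_vec (dim_col A)}"

text \<open>
  \<open>minimal_free_resolution I F A\<close>: with \<open>F = [F\<^sub>1, \<dots>, F\<^sub>r]\<close> and
  \<open>A = [A\<^sub>1, \<dots>, A\<^sub>r]\<close>, the complex
  \<open>0 \<rightarrow> F\<^sub>r \<rightarrow> \<dots> \<rightarrow> F\<^sub>1 \<rightarrow> S\<close> with differentials
  \<open>A\<^sub>i : F\<^sub>i \<rightarrow> F\<^sub>i\<^sub>-\<^sub>1\<close> is a minimal graded free resolution of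
  \<open>S / I\<close>. The final map \<open>S \<rightarrow> S / I\<close> is omitted: its exactness is the condition
  that the image of \<open>A\<^sub>1\<close> is \<open>I\<close>.
\<close>

definition minimal_free_resolution :: "S set \<Rightarrow> int list list \<Rightarrow> S mat list \<Rightarrow> bool" where
  "minimal_free_resolution I F A \<longleftrightarrow>
     A \<noteq> [] \<and> length A = length F \<and>
     (\<forall>i<length A. graded_map (F ! i) (([0] # F) ! i) (A ! i)) \<and>
     mat_image (A ! 0) = {v \<in> carrier_vec 1. v $ 0 \<in> I} \<and>
     (\<forall>i. Suc i < length A \<longrightarrow> mat_image (A ! Suc i) = mat_kernel (A ! i)) \<and>
     mat_kernel (last A) = {0\<^sub>v (length (last F))} \<and>
     (\<forall>B\<in>set A. elements_mat B \<subseteq> irrelevant_ideal)"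

text \<open>The minimal graded free resolution is unique up to isomorphism, so that having the form
  given by the twists \<open>F\<close> is an existence statement.\<close>

definition minimal_resolution_form :: "S set \<Rightarrow> int list list \<Rightarrow> bool" where
  "minimal_resolution_form I F \<longleftrightarrow> (\<exists>A. minimal_free_resolution I F A)"

section \<open>Nearly free curves\<close>

definition reduced_curve :: "S \<Rightarrow> nat \<Rightarrow> bool" where
  "reduced_curve f d \<longleftrightarrow> homogeneous (int d) f \<and> squarefree f"

definition nearly_free :: "S \<Rightarrow> bool" where
  "nearly_free f \<longleftrightarrow> nu_C f = 1"

definition exponents :: "S \<Rightarrow> nat \<Rightarrow> int \<Rightarrow> int \<Rightarrow> bool" where
  "exponents f d d1 d2 \<longleftrightarrow>
     d1 \<le> d2 \<and> d1 + d2 = int d \<and>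
     (\<exists>A. minimal_free_resolution (jacobian_ideal f)
            [[int d - 1, int d - 1, int d - 1],
             [int d + d1 - 1, int d + d2 - 1, int d + d2 - 1],
             [int d + d2]] A \<and>
          A ! 0 = mat_of_row (vec_of_list [pdiff 0 f, pdiff 1 f, pdiff 2 f]))"

end

theory Submission
  imports Defs
begin

text \<open>
  Let \<open>v = (a, l\<^sub>1, l\<^sub>2)\<close> be the last differential of the resolution of \<open>S / J\<^sub>f\<close> and \<open>r\<^sub>0, r\<^sub>1, r\<^sub>2\<close> the
  columns of the previous one. Exactness forces \<open>v\<close> to be a regular sequence generating an
  ideal primary to the irrelevant ideal: if its entries lay in an ideal generated by a regular pair of non-units, the resolution could be
  shortened. As \<open>a r\<^sub>0 + l\<^sub>1 r\<^sub>1 + l\<^sub>2 r\<^sub>2 = 0\<close>, the Koszul complex of \<open>v\<close> gives vectors \<open>w\<^sub>0, w\<^sub>1, w\<^sub>2\<close> with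
  \<open>r = w \<times> v\<close>. The relations \<open>\<nabla>f \<cdot> r\<^sub>k = 0\<close> then say that \<open>(\<nabla>f \<cdot> w\<^sub>k)\<close> is proportional to \<open>v\<close>, so
  \<open>\<nabla>f \<cdot> w\<^sub>k = h v\<^sub>k\<close> for some \<open>h\<close> of degree \<open>d + d\<^sub>1 - 3\<close>. One finds \<open>J\<^sub>f : h = (a, l\<^sub>1, l\<^sub>2)\<close> and
  \<open>I\<^sub>f = J\<^sub>f + (h)\<close>, hence \<open>\<sigma>(C) = d + d\<^sub>1 - 3\<close>, and the relations between \<open>f\<^sub>x, f\<^sub>y, f\<^sub>z, h\<close> are freely
  generated by the \<open>(w\<^sub>k, -v\<^sub>k)\<close>. This resolution of \<open>S / I\<^sub>f\<close> is minimal unless \<open>d\<^sub>1 = 1\<close>; in that case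
  \<open>w\<^sub>1, w\<^sub>2\<close> are constant and allow two of the partial derivatives to be eliminated.
\<close>

section \<open>Homogeneous components and substitutions\<close>

lemma S_induct [case_names single add]:
  fixes p :: S
  assumes "\<And>t c. P (Poly_Mapping.single t c)" and "\<And>p q. P p \<Longrightarrow> P q \<Longrightarrow> P (p + q)"
  shows "P p"
proof -
  have dec: "p = (\<Sum>t\<in>Poly_Mapping.keys p. Poly_Mapping.single t (Poly_Mapping.lookup p t))"
    by (rule poly_mapping_eqI)
      (simp add: lookup_sum lookup_single when_def sum.delta in_keys_iff)
  have "P (\<Sum>t\<in>A. Poly_Mapping.single t (Poly_Mapping.lookup p t))" if "finite A" for A
    using that assms(1)[of 0 0] by (induction A) (auto intro: assms)
  then show ?thesis by (subst dec) simp
qed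

lemma Cst_simps [simp]:
  "Cst 0 = 0" "Cst 1 = 1" "Cst (a + b) = Cst a + Cst b" "Cst (a * b) = Cst a * Cst b"
  "Cst (- a) = - Cst a" "Cst (a - b) = Cst a - Cst b"
  by (simp_all add: Cst_def single_add mult_single single_uminus single_diff)

lemma mdeg_add: "mdeg (t + u) = mdeg t + mdeg u"
  by (simp add: mdeg_def lookup_add sum.distrib)

lemma mdeg_eq_0_iff: "mdeg t = 0 \<longleftrightarrow> t = 0"
  by (auto simp: mdeg_def poly_mapping_eq_iff fun_eq_iff)

lemma mdeg_single [simp]: "mdeg (Poly_Mapping.single i n) = n"
  by (simp add: mdeg_def lookup_single when_def)

section \<open>Projection onto the degree \<open>k\<close> component\<close>

definition hcomp :: "int \<Rightarrow> S \<Rightarrow> S" where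
  "hcomp k p = Poly_Mapping.mapp (\<lambda>t c. c when int (mdeg t) = k) p"

lemma lookup_hcomp:
  "Poly_Mapping.lookup (hcomp k p) t = (Poly_Mapping.lookup p t when int (mdeg t) = k)"
  by (auto simp: hcomp_def lookup_mapp when_def in_keys_iff)

lemma hcomp_add [simp]: "hcomp k (p + q) = hcomp k p + hcomp k q"
  by (rule poly_mapping_eqI) (simp add: lookup_hcomp lookup_add when_def)

lemma hcomp_diff [simp]: "hcomp k (p - q) = hcomp k p - hcomp k q"
  by (rule poly_mapping_eqI) (simp add: lookup_hcomp lookup_minus when_def)

lemma hcomp_0 [simp]: "hcomp k 0 = 0"
  by (rule poly_mapping_eqI) (simp add: lookup_hcomp)

lemma hcomp_sum: "hcomp k (sum f A) = (\<Sum>i\<in>A. hcomp k (f i))"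
  by (induction A rule: infinite_finite_induct) auto

lemma hcomp_single:
  "hcomp k (Poly_Mapping.single t c) = (if int (mdeg t) = k then Poly_Mapping.single t c else 0)"
  by (rule poly_mapping_eqI) (auto simp: lookup_hcomp lookup_single when_def)

lemma homogeneous_hcomp [simp]: "homogeneous k (hcomp k p)"
  by (auto simp: homogeneous_def in_keys_iff lookup_hcomp when_def split: if_splits)

lemma homogeneous_iff_hcomp: "homogeneous k p \<longleftrightarrow> hcomp k p = p"
proof
  assume "homogeneous k p"
  then show "hcomp k p = p"
    by (intro poly_mapping_eqI) (auto simp: homogeneous_def lookup_hcomp when_def in_keys_iff)
qed (metis homogeneous_hcomp)

lemma hcomp_neg: "k < 0 \<Longrightarrow> hcomp k p = 0"
  by (rule poly_mapping_eqI) (auto simp: lookup_hcomp when_def)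

lemma homogeneous_neg: "homogeneous k p \<Longrightarrow> k < 0 \<Longrightarrow> p = 0"
  by (simp add: homogeneous_iff_hcomp hcomp_neg)

text \<open>Multiplication by a form shifts the grading. Linear equations with homogeneous
  coefficients therefore pass to components, which later makes the unknowns homogeneous.\<close>

lemma hcomp_mult:
  assumes "homogeneous e a"
  shows "hcomp k (a * p) = a * hcomp (k - e) p"
proof -
  \<comment> \<open>With \<open>hcomp e a\<close> in place of \<open>a\<close> the claim is additive
    in \<open>a\<close>, so the induction need not preserve homogeneity.\<close>
  have "hcomp k (hcomp e a * p) = hcomp e a * hcomp (k - e) p"
  proof (induction a rule: S_induct)
    case (single t c)
    show ?case
      by (induction p rule: S_induct)
        (auto simp: hcomp_single mult_single mdeg_add algebra_simps)
  qed (simp add: algebra_simps)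
  with assms show ?thesis by (simp add: homogeneous_iff_hcomp)
qed

lemma homogeneous_0 [simp]: "homogeneous k 0"
  by (simp add: homogeneous_def)

lemma homogeneous_add: "homogeneous k p \<Longrightarrow> homogeneous k q \<Longrightarrow> homogeneous k (p + q)"
  by (simp add: homogeneous_iff_hcomp)

lemma homogeneous_diff: "homogeneous k p \<Longrightarrow> homogeneous k q \<Longrightarrow> homogeneous k (p - q)"
  by (simp add: homogeneous_iff_hcomp)

lemma homogeneous_uminus: "homogeneous k p \<Longrightarrow> homogeneous k (- p)"
  using homogeneous_diff[of k 0 p] by simp

lemma homogeneous_sum: "(\<And>i. i \<in> A \<Longrightarrow> homogeneous k (f i)) \<Longrightarrow> homogeneous k (sum f A)"
  by (simp add: homogeneous_iff_hcomp hcomp_sum)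

lemma homogeneous_mult:
  assumes "homogeneous j p" "homogeneous k q" "l = j + k"
  shows "homogeneous l (p * q)"
  using assms by (simp add: homogeneous_iff_hcomp hcomp_mult)

lemma homogeneous_cancel:
  assumes "homogeneous e a" "a \<noteq> 0" "homogeneous k (a * p)"
  shows "homogeneous (k - e) p"
proof -
  have "a * hcomp (k - e) p = a * p"
    using assms by (simp add: homogeneous_iff_hcomp hcomp_mult[symmetric])
  with assms show ?thesis by (simp add: homogeneous_iff_hcomp)
qed

lemma homogeneous_Cst [simp]: "homogeneous 0 (Cst c)"
  by (auto simp: homogeneous_def Cst_def mdeg_eq_0_iff)

lemma homogeneous_mult_Cst: "homogeneous k p \<Longrightarrow> homogeneous k (p * Cst c)"
  "homogeneous k p \<Longrightarrow> homogeneous k (Cst c * p)"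
  using homogeneous_mult[OF _ homogeneous_Cst, of k p] homogeneous_mult[OF homogeneous_Cst, of k p] by auto

lemma homogeneous_0_Cst:
  assumes "homogeneous 0 p"
  shows "p = Cst (Poly_Mapping.lookup p 0)"
  using assms
  by (intro poly_mapping_eqI)
    (auto simp: homogeneous_def Cst_def lookup_single when_def in_keys_iff mdeg_eq_0_iff)

lemma mdeg_eq_SucE:
  assumes "mdeg t = Suc n"
  obtains i u where "t = Poly_Mapping.single i 1 + u" "mdeg u = n"
proof -
  from assms have "t \<noteq> 0" by (auto simp: mdeg_def)
  then obtain i where i: "Poly_Mapping.lookup t i \<noteq> 0"
    by (metis lookup_zero poly_mapping_eqI)
  have t: "t = Poly_Mapping.single i 1 + (t - Poly_Mapping.single i 1)"
    using i by (intro poly_mapping_eqI) (auto simp: lookup_add lookup_minus lookup_single when_def)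
  have "mdeg t = 1 + mdeg (t - Poly_Mapping.single i 1)"
    by (subst t, subst mdeg_add) simp
  with assms have "mdeg (t - Poly_Mapping.single i 1) = n" by simp
  with t that show thesis by blast
qed

lemma linear_form_expansion:
  assumes "homogeneous 1 l"
  obtains b where "l = (\<Sum>i\<in>UNIV. Cst (b i) * Var i)"
proof
  let ?b = "\<lambda>i. Poly_Mapping.lookup l (Poly_Mapping.single i 1)"
  show "l = (\<Sum>i\<in>UNIV. Cst (?b i) * Var i)"
  proof (rule poly_mapping_eqI)
    fix t
    show "Poly_Mapping.lookup l t = Poly_Mapping.lookup (\<Sum>i\<in>UNIV. Cst (?b i) * Var i) t"
    proof (cases "mdeg t = 1")
      case True
      then obtain i u where "t = Poly_Mapping.single i 1 + u" "mdeg u = 0"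
        using mdeg_eq_SucE[of t 0] by auto
      then have t: "t = Poly_Mapping.single i 1" by (simp add: mdeg_eq_0_iff)
      have "Poly_Mapping.single j (1::nat) = Poly_Mapping.single i 1 \<longleftrightarrow> j = i" for j
        by (metis lookup_single_eq lookup_single_not_eq one_neq_zero)
      then show ?thesis
        by (simp add: t Cst_def Var_def mult_single lookup_sum lookup_single when_def)
    next
      case False
      with assms have "Poly_Mapping.lookup l t = 0"
        by (auto simp: homogeneous_def in_keys_iff)
      moreover have "Poly_Mapping.single j (1::nat) \<noteq> t" for j
        using False by auto
      ultimately show ?thesis
        by (simp add: Cst_def Var_def mult_single lookup_sum lookup_single when_def)
    qed
  qed
qed

section \<open>Algebra endomorphisms given by the images of the variables\<close>

definition subst :: "(3 \<Rightarrow> S) \<Rightarrow> S \<Rightarrow> S" where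
  "subst g p = (\<Sum>t\<in>Poly_Mapping.keys p.
     Cst (Poly_Mapping.lookup p t) * (\<Prod>i\<in>UNIV. g i ^ Poly_Mapping.lookup t i))"

text \<open>Coefficients outside the support vanish, so \<open>p\<close>, \<open>q\<close> and
  \<open>p + q\<close> can be summed over one index set in spite of their different
  supports.\<close>

lemma subst_superset:
  assumes "finite A" "Poly_Mapping.keys p \<subseteq> A"
  shows "subst g p = (\<Sum>t\<in>A. Cst (Poly_Mapping.lookup p t) * (\<Prod>i\<in>UNIV. g i ^ Poly_Mapping.lookup t i))"
  unfolding subst_def using assms by (intro sum.mono_neutral_left) (auto simp: in_keys_iff)

lemma subst_add [simp]: "subst g (p + q) = subst g p + subst g q"
proof -
  let ?A = "Poly_Mapping.keys p \<union> Poly_Mapping.keys q"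
  show ?thesis
    using Poly_Mapping.keys_add[of p q]
    by (simp add: subst_superset[of ?A] lookup_add algebra_simps sum.distrib)
qed

lemma subst_0 [simp]: "subst g 0 = 0"
  by (simp add: subst_def)

lemma subst_single:
  "subst g (Poly_Mapping.single t c) = Cst c * (\<Prod>i\<in>UNIV. g i ^ Poly_Mapping.lookup t i)"
  by (cases "c = 0") (simp_all add: subst_def)

lemma subst_mult [simp]: "subst g (p * q) = subst g p * subst g q"
proof (induction p rule: S_induct)
  case (single t c)
  show ?case
    by (induction q rule: S_induct)
      (simp_all add: mult_single subst_single lookup_add power_add prod.distrib algebra_simps)
qed (simp add: algebra_simps)

lemma subst_Cst [simp]: "subst g (Cst c) = Cst c"
  using subst_single[of g 0 c] by (simp add: Cst_def)

lemma subst_Var [simp]: "subst g (Var i) = g i"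
proof -
  have "(\<Prod>j\<in>UNIV. g j ^ Poly_Mapping.lookup (Poly_Mapping.single i (1::nat)) j) = (\<Prod>j\<in>UNIV. if j = i then g j else 1)"
    by (rule prod.cong) (auto simp: lookup_single when_def)
  then show ?thesis by (simp add: Var_def subst_single)
qed

lemma subst_uminus [simp]: "subst g (- p) = - subst g p"
proof -
  have "subst g (- p) + subst g p = subst g (- p + p)" by (rule subst_add[symmetric])
  also have "\<dots> = 0" by (simp del: subst_add)
  finally show ?thesis by (simp only: eq_neg_iff_add_eq_0)
qed

lemma subst_diff [simp]: "subst g (p - q) = subst g p - subst g q"
  by (simp only: diff_conv_add_uminus subst_add subst_uminus)

lemma subst_sum: "subst g (sum f A) = (\<Sum>i\<in>A. subst g (f i))"
  by (induction A rule: infinite_finite_induct) auto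

section \<open>Ideals, linear forms and points\<close>

lemma S_module: "Modules.module ((*) :: S \<Rightarrow> S \<Rightarrow> S)"
  by unfold_locales (simp_all add: algebra_simps)

lemma ideal_gen_add: "p \<in> ideal_gen B \<Longrightarrow> q \<in> ideal_gen B \<Longrightarrow> p + q \<in> ideal_gen B"
  unfolding ideal_gen_def by (rule Modules.module.span_add[OF S_module])

lemma ideal_gen_mult: "p \<in> ideal_gen B \<Longrightarrow> q * p \<in> ideal_gen B"
  unfolding ideal_gen_def by (rule Modules.module.span_scale[OF S_module])

lemma ideal_gen_subset:
  assumes "B \<subseteq> K" "0 \<in> K" "\<And>p q. p \<in> K \<Longrightarrow> q \<in> K \<Longrightarrow> p + q \<in> K" "\<And>p q. p \<in> K \<Longrightarrow> q * p \<in> K"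
  shows "ideal_gen B \<subseteq> K"
proof
  fix p assume "p \<in> ideal_gen B"
  then have "p \<in> Modules.module.span (*) B" by (simp add: ideal_gen_def)
  then show "p \<in> K"
    by (induction rule: Modules.module.span_induct_alt[OF S_module, consumes 1]) (use assms in auto)
qed

lemma irrelevant_ideal_add:
  "p \<in> irrelevant_ideal \<Longrightarrow> q \<in> irrelevant_ideal \<Longrightarrow> p + q \<in> irrelevant_ideal"
  unfolding irrelevant_ideal_def by (rule ideal_gen_add)

lemma irrelevant_ideal_mult: "p \<in> irrelevant_ideal \<Longrightarrow> q * p \<in> irrelevant_ideal"
  unfolding irrelevant_ideal_def by (rule ideal_gen_mult)

lemma irrelevant_ideal_mult': "p \<in> irrelevant_ideal \<Longrightarrow> p * q \<in> irrelevant_ideal"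
  by (metis irrelevant_ideal_mult mult.commute)

lemma Var_in_irrelevant_ideal: "Var i \<in> irrelevant_ideal"
  unfolding irrelevant_ideal_def ideal_gen_def by (rule Modules.module.span_base[OF S_module]) simp

text \<open>The polynomials without constant term form an ideal that contains the variables.\<close>

lemma hcomp_0_irrelevant_ideal:
  assumes "p \<in> irrelevant_ideal"
  shows "hcomp 0 p = 0"
proof -
  have "irrelevant_ideal \<subseteq> {p. hcomp 0 p = 0}"
    unfolding irrelevant_ideal_def
  proof (rule ideal_gen_subset)
    show "range Var \<subseteq> {p. hcomp 0 p = 0}"
      by (auto simp: Var_def hcomp_single)
    fix p q assume "p \<in> {p. hcomp 0 p = 0}"
    then have *: "hcomp 0 p = 0" by simp
    have "hcomp 0 (q * p) = 0"
    proof (induction q rule: S_induct)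
      case (single t c)
      have "homogeneous (int (mdeg t)) (Poly_Mapping.single t c)" by (auto simp: homogeneous_def)
      \<comment> \<open>A nonconstant term of the factor \<open>q\<close> would need a component of
        \<open>p\<close> of negative degree.\<close>
      with * show ?case by (cases "mdeg t = 0") (auto simp: hcomp_mult hcomp_neg)
    qed (simp add: algebra_simps)
    then show "q * p \<in> {p. hcomp 0 p = 0}" by simp
  qed auto
  with assms show ?thesis by auto
qed

lemma one_not_in_irrelevant_ideal: "1 \<notin> irrelevant_ideal"
proof
  assume "1 \<in> irrelevant_ideal"
  then have "hcomp 0 1 = 0" by (rule hcomp_0_irrelevant_ideal)
  moreover have "homogeneous 0 1" using homogeneous_Cst[of 1] by simp
  ultimately show False by (simp add: homogeneous_iff_hcomp)
qed

lemma homogeneous_irrelevant_pos: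
  assumes "homogeneous k p" "p \<in> irrelevant_ideal" "p \<noteq> 0"
  shows "1 \<le> k"
proof (rule ccontr)
  assume "\<not> 1 \<le> k"
  then consider "k < 0" | "k = 0" by linarith
  then show False
    using assms hcomp_0_irrelevant_ideal homogeneous_iff_hcomp homogeneous_neg by cases auto
qed

text \<open>Every term of positive degree is divisible by a variable.\<close>

lemma homogeneous_in_irrelevant_ideal:
  assumes "homogeneous k p" "1 \<le> k"
  shows "p \<in> irrelevant_ideal"
proof -
  have "hcomp k q \<in> irrelevant_ideal" for q
  proof (induction q rule: S_induct)
    case (single t c)
    show ?case
    proof (cases "int (mdeg t) = k")
      case True
      with assms(2) obtain n where "mdeg t = Suc n" by (metis Suc_pred' of_nat_0_less_iff zero_less_one_class.zero_less_one order_less_le_trans)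
      then obtain i u where "t = Poly_Mapping.single i 1 + u" by (rule mdeg_eq_SucE)
      then have "Poly_Mapping.single t c = Poly_Mapping.single u c * Var i"
        by (simp add: Var_def mult_single add.commute)
      with True show ?thesis
        by (metis hcomp_single irrelevant_ideal_mult Var_in_irrelevant_ideal)
    next
      case False
      then show ?thesis
        using irrelevant_ideal_mult[OF Var_in_irrelevant_ideal, of 0] by (simp add: hcomp_single)
    qed
  qed (simp add: irrelevant_ideal_add)
  with assms(1) show ?thesis by (metis homogeneous_iff_hcomp)
qed

text \<open>Modulo \<open>K\<close> each variable equals its image, hence so does each monomial, by
  splitting off one variable at a time. This is how kernels of substitutions are identified
  below.\<close>

lemma subst_congruent:
  assumes "\<And>i. Var i - g i \<in> K" and "\<And>p q. p \<in> K \<Longrightarrow> q \<in> K \<Longrightarrow> p + q \<in> K" and "\<And>p q. p \<in> K \<Longrightarrow> q * p \<in> K"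
  shows "p - subst g p \<in> K"
proof (induction p rule: S_induct)
  case (single t c)
  have z: "0 \<in> K" using assms(1)[of 0] assms(3)[of _ 0] by fastforce
  show ?case
  proof (induction "mdeg t" arbitrary: t)
    case 0
    then have "Poly_Mapping.single t c = Cst c" by (simp add: Cst_def mdeg_eq_0_iff)
    then show ?case using z by simp
  next
    case (Suc n)
    obtain i u where iu: "t = Poly_Mapping.single i 1 + u" "mdeg u = n"
      using mdeg_eq_SucE Suc(2) by metis
    let ?q = "Poly_Mapping.single u c"
    have "Poly_Mapping.single t c = Var i * ?q"
      by (simp add: Var_def mult_single iu)
    then have "Poly_Mapping.single t c - subst g (Poly_Mapping.single t c)
        = Var i * (?q - subst g ?q) + subst g ?q * (Var i - g i)"
      by (simp add: algebra_simps)
    moreover have "?q - subst g ?q \<in> K" using Suc iu by blast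
    ultimately show ?case using assms by simp
  qed
next
  case (add p q)
  have eq: "p + q - subst g (p + q) = (p - subst g p) + (q - subst g q)" by simp
  show ?case unfolding eq using add assms(2) by blast
qed

section \<open>Primality of ideals generated by linear forms\<close>

lemma Cst_inverse:
  assumes "c \<noteq> 0"
  shows "Cst c * Cst (inverse c) = 1" "Cst (inverse c) * Cst c = 1"
  by (metis assms Cst_simps(2,4) right_inverse, metis assms Cst_simps(2,4) left_inverse)

text \<open>Solving \<open>l = 0\<close> for a variable that occurs in \<open>l\<close> gives an
  endomorphism that kills \<open>l\<close> and is the identity modulo \<open>l\<close>. Its kernel
  is thus the ideal of \<open>l\<close>, and its values lie in a domain.\<close>

lemma linear_form_prime:
  assumes l: "homogeneous 1 l" "l \<noteq> 0" and dvd: "l dvd p * q"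
  shows "l dvd p \<or> l dvd q"
proof -
  obtain b where b: "l = (\<Sum>i\<in>UNIV. Cst (b i) * Var i)"
    using l(1) by (rule linear_form_expansion)
  have "\<exists>j. b j \<noteq> 0"
  proof (rule ccontr)
    assume "\<not> ?thesis"
    then have "l = 0" unfolding b by simp
    with l(2) show False ..
  qed
  then obtain j where j: "b j \<noteq> 0" ..
  \<comment> \<open>Subtracting \<open>l\<close> divided by \<open>b j\<close> from
    \<open>Var j\<close> changes \<open>l\<close> itself by exactly \<open>- l\<close>.\<close>
  let ?g = "\<lambda>i. if i = j then Var i - Cst (inverse (b j)) * l else Var i"
  have "subst ?g l = subst ?g (\<Sum>i\<in>UNIV. Cst (b i) * Var i)" by (simp only: b[symmetric])
  also have "\<dots> = (\<Sum>i\<in>UNIV. Cst (b i) * Var i - (if i = j then Cst (b j) * Cst (inverse (b j)) * l else 0))"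
    unfolding subst_sum
  proof (rule sum.cong)
    fix i
    show "subst ?g (Cst (b i) * Var i) = Cst (b i) * Var i - (if i = j then Cst (b j) * Cst (inverse (b j)) * l else 0)"
      by (cases "i = j")
        (simp_all only: subst_mult subst_Cst subst_Var right_diff_distrib mult.assoc diff_0_right if_True if_False simp_thms)
  qed simp
  also have "\<dots> = l - Cst (b j) * Cst (inverse (b j)) * l"
    by (simp only: sum_subtractf b[symmetric] sum.delta finite UNIV_I if_True)
  finally have sl: "subst ?g l = 0"
    by (simp only: Cst_inverse(1)[OF j] mult_1_left diff_self)
  have cong: "l dvd r - subst ?g r" for r
  proof -
    have "r - subst ?g r \<in> {r. l dvd r}"
      by (rule subst_congruent) auto
    then show ?thesis by simp
  qed
  from dvd obtain r where "p * q = l * r" by (rule dvdE)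
  then have "subst ?g (p * q) = 0" by (simp only: subst_mult sl mult_zero_left)
  then have "subst ?g p = 0 \<or> subst ?g q = 0" by simp
  then show ?thesis using cong[of p] cong[of q] by auto
qed

lemma Cst_power: "Cst (c ^ n) = Cst c ^ n"
  by (induction n) auto

lemma Cst_prod: "Cst (prod f A) = (\<Prod>i\<in>A. Cst (f i))"
  by (induction A rule: infinite_finite_induct) auto

lemma Cst_sum: "Cst (sum f A) = (\<Sum>i\<in>A. Cst (f i))"
  by (induction A rule: infinite_finite_induct) auto

text \<open>Here \<open>\<mu>\<close> is a point and \<open>x\<close> the coordinate on the line
  through it; the witness \<open>?\<gamma>\<close> is the value of \<open>p\<close> at
  \<open>\<mu>\<close>.\<close>

lemma subst_line_homogeneous:
  assumes "homogeneous (int n) p"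
  shows "\<exists>\<gamma>. subst (\<lambda>i. Cst (\<mu> i) * x) p = Cst \<gamma> * x ^ n"
proof
  let ?\<gamma> = "\<Sum>t\<in>Poly_Mapping.keys p. Poly_Mapping.lookup p t * (\<Prod>i\<in>UNIV. \<mu> i ^ Poly_Mapping.lookup t i)"
  have *: "(\<Prod>i\<in>UNIV. (Cst (\<mu> i) * x) ^ Poly_Mapping.lookup t i)
      = Cst (\<Prod>i\<in>UNIV. \<mu> i ^ Poly_Mapping.lookup t i) * x ^ n"
    if "t \<in> Poly_Mapping.keys p" for t
  proof -
    have "mdeg t = n" using assms that by (auto simp: homogeneous_def)
    then have "(\<Prod>i\<in>UNIV. x ^ Poly_Mapping.lookup t i) = x ^ n"
      by (simp only: power_sum[symmetric] mdeg_def)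
    then show ?thesis
      by (simp only: power_mult_distrib prod.distrib Cst_prod Cst_power)
  qed
  show "subst (\<lambda>i. Cst (\<mu> i) * x) p = Cst ?\<gamma> * x ^ n"
    unfolding subst_def Cst_sum sum_distrib_right
    by (rule sum.cong[OF refl]) (simp only: * Cst_simps mult.assoc)
qed

text \<open>Stated over any commutative ring because the Koszul arguments below are carried out over
  an arbitrary integral domain.\<close>

definition in_ideal2 :: "'r :: comm_ring_1 \<Rightarrow> 'r \<Rightarrow> 'r \<Rightarrow> bool" where
  "in_ideal2 l1 l2 p \<longleftrightarrow> (\<exists>u v. p = l1 * u + l2 * v)"

lemma in_ideal2_add: "in_ideal2 l1 l2 p \<Longrightarrow> in_ideal2 l1 l2 q \<Longrightarrow> in_ideal2 l1 l2 (p + q)"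
  unfolding in_ideal2_def
  by (elim exE, rename_tac u v u' v') (rule_tac x = "u + u'" in exI, rule_tac x = "v + v'" in exI, simp add: algebra_simps)

lemma in_ideal2_mult: "in_ideal2 l1 l2 p \<Longrightarrow> in_ideal2 l1 l2 (q * p)"
  unfolding in_ideal2_def
  by (elim exE, rename_tac u v) (rule_tac x = "q * u" in exI, rule_tac x = "q * v" in exI, simp add: algebra_simps)

lemma third_index:
  assumes "i \<noteq> (k :: 3)"
  obtains j where "UNIV = {i, j, k}" "j \<noteq> i" "j \<noteq> k"
proof -
  have "card {i, k} \<noteq> CARD(3)" using assms by simp
  then have "{i, k} \<noteq> UNIV" by metis
  then obtain j where j: "j \<noteq> i" "j \<noteq> k" by blast
  then have "{i, j, k} = UNIV" using assms by (intro card_subset_eq) auto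
  with j that show thesis by blast
qed

text \<open>When all minors vanish the coefficient vectors are proportional, with factor
  \<open>b' j / b j\<close> for a nonzero \<open>b j\<close>.\<close>

lemma minors_eq_imp_dvd:
  assumes l: "l1 = (\<Sum>i\<in>UNIV. Cst (b i) * Var i)" "l2 = (\<Sum>i\<in>UNIV. Cst (b' i) * Var i)"
    and "l1 \<noteq> 0" and eq: "\<And>i k. b i * b' k = b k * b' i"
  shows "l1 dvd l2"
proof -
  from assms obtain j where j: "b j \<noteq> 0" by fastforce
  have bl: "Cst (b j) * l2 = Cst (b' j) * l1"
    unfolding l sum_distrib_left by (rule sum.cong) (simp_all add: eq[of j] mult.assoc[symmetric] flip: Cst_simps(4), simp add: mult.commute)
  have "l2 = Cst (inverse (b j)) * Cst (b j) * l2"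
    using j by (simp add: Cst_inverse)
  also have "\<dots> = l1 * (Cst (inverse (b j)) * Cst (b' j))"
    by (simp only: mult.assoc bl) (simp only: mult_ac)
  finally show ?thesis by (metis dvd_triv_left)
qed

text \<open>The common zero of \<open>l1, l2\<close> is the point \<open>\<mu>\<close> of the projective plane, normalised by \<open>\<mu> j = 1\<close>; the
  substitution restricts polynomials to the line through the origin that it represents.\<close>

lemma common_zero:
  assumes hom: "homogeneous 1 l1" "homogeneous 1 l2" and ndvd: "\<not> l1 dvd l2" and nz: "l1 \<noteq> 0"
  obtains j \<mu> where
    "subst (\<lambda>i. Cst (\<mu> i) * Var j) l1 = 0"
    "subst (\<lambda>i. Cst (\<mu> i) * Var j) l2 = 0"
    "\<And>p. in_ideal2 l1 l2 (p - subst (\<lambda>i. Cst (\<mu> i) * Var j) p)"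
proof -
  obtain b where l1: "l1 = (\<Sum>i\<in>UNIV. Cst (b i) * Var i)" using hom(1) by (rule linear_form_expansion)
  obtain b' where l2: "l2 = (\<Sum>i\<in>UNIV. Cst (b' i) * Var i)" using hom(2) by (rule linear_form_expansion)
  obtain i k where ik: "b i * b' k \<noteq> b k * b' i"
    using minors_eq_imp_dvd[OF l1 l2 nz] ndvd by blast
  then have "i \<noteq> k" by auto
  then obtain j where univ: "(UNIV :: 3 set) = {i, j, k}" and dist: "j \<noteq> i" "j \<noteq> k"
    by (rule third_index)
  \<comment> \<open>Cramer's rule: \<open>\<mu>\<close> is the cross product of the two coefficient
    vectors divided by its \<open>j\<close>-th entry, which up to sign is the nonzero minor inverted
    in \<open>\<delta>\<close>.\<close>
  define \<delta> where "\<delta> = inverse (b i * b' k - b k * b' i)"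
  define \<mu> where "\<mu> n = (if n = i then (b k * b' j - b j * b' k) * \<delta>
      else if n = k then (b j * b' i - b i * b' j) * \<delta> else 1)" for n
  have \<delta>: "(b i * b' k - b k * b' i) * \<delta> = 1" using ik by (simp add: \<delta>_def)
  have sum3: "(\<Sum>n\<in>UNIV. f n) = f i + f j + f k" for f :: "3 \<Rightarrow> S"
    unfolding univ using dist \<open>i \<noteq> k\<close> by (simp add: add.assoc)
  have \<mu>: "\<mu> i = (b k * b' j - b j * b' k) * \<delta>" "\<mu> k = (b j * b' i - b i * b' j) * \<delta>" "\<mu> j = 1"
    using dist \<open>i \<noteq> k\<close> by (auto simp: \<mu>_def)
  let ?g = "\<lambda>i. Cst (\<mu> i) * Var j"
  have s: "subst ?g (\<Sum>i\<in>UNIV. Cst (c i) * Var i) = Cst (c i * \<mu> i + c j * \<mu> j + c k * \<mu> k) * Var j" for c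
    by (simp add: sum3 algebra_simps)
  have "b i * \<mu> i + b j * \<mu> j + b k * \<mu> k = b j * (1 - (b i * b' k - b k * b' i) * \<delta>)"
    "b' i * \<mu> i + b' j * \<mu> j + b' k * \<mu> k = b' j * (1 - (b i * b' k - b k * b' i) * \<delta>)"
    unfolding \<mu> by (simp_all add: algebra_simps)
  then have "b i * \<mu> i + b j * \<mu> j + b k * \<mu> k = 0" "b' i * \<mu> i + b' j * \<mu> j + b' k * \<mu> k = 0"
    unfolding \<delta> by simp_all
  then have "subst ?g l1 = 0" "subst ?g l2 = 0"
    unfolding l1 l2 s by simp_all
  moreover have "in_ideal2 l1 l2 (p - subst ?g p)" for p
  proof -
    have C\<delta>: "(Cst (b i) * Cst (b' k) - Cst (b k) * Cst (b' i)) * Cst \<delta> = 1"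
      using arg_cong[OF \<delta>, of Cst] by simp
    have "in_ideal2 l1 l2 (Var n - ?g n)" for n
    proof -
      have "n = i \<or> n = j \<or> n = k" using univ by blast
      \<comment> \<open>The factors of \<open>l1\<close> and \<open>l2\<close>, here and for
        \<open>Var k\<close>, are the rows of the inverse of the matrix of coefficients of
        \<open>Var i\<close> and \<open>Var k\<close>.\<close>
      moreover have "Var i - ?g i = l1 * (Cst (b' k) * Cst \<delta>) + l2 * (- Cst (b k) * Cst \<delta>)"
      proof -
        have "Var i - ?g i = 1 * Var i - ?g i" by simp
        then show ?thesis
          unfolding l1 l2 sum3 \<mu> Cst_simps C\<delta>[symmetric] by (simp add: algebra_simps)
      qed
      moreover have "Var k - ?g k = l1 * (- Cst (b' i) * Cst \<delta>) + l2 * (Cst (b i) * Cst \<delta>)"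
      proof -
        have "Var k - ?g k = 1 * Var k - ?g k" by simp
        then show ?thesis
          unfolding l1 l2 sum3 \<mu> Cst_simps C\<delta>[symmetric] by (simp add: algebra_simps)
      qed
      moreover have "Var j - ?g j = l1 * 0 + l2 * 0" unfolding \<mu> by simp
      ultimately show ?thesis unfolding in_ideal2_def by blast
    qed
    then have "p - subst ?g p \<in> {p. in_ideal2 l1 l2 p}"
      by (intro subst_congruent) (auto intro: in_ideal2_add in_ideal2_mult)
    then show ?thesis by simp
  qed
  ultimately show thesis by (rule that)
qed

lemma in_ideal2_subst:
  assumes "subst g l1 = 0" "subst g l2 = 0" "\<And>p. in_ideal2 l1 l2 (p - subst g p)"
  shows "in_ideal2 l1 l2 p \<longleftrightarrow> subst g p = 0"
proof
  assume "in_ideal2 l1 l2 p"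
  then obtain u v where "p = l1 * u + l2 * v" by (auto simp: in_ideal2_def)
  then show "subst g p = 0" by (simp add: assms)
qed (use assms(3)[of p] in simp)

text \<open>By \<open>common_zero\<close> the ideal is the kernel of the restriction to a line, a
  homomorphism into a domain.\<close>

lemma linear_forms_prime_ideal:
  assumes hom: "homogeneous 1 l1" "homogeneous 1 l2" and ndvd: "\<not> l1 dvd l2" "l1 \<noteq> 0"
    and "\<not> in_ideal2 l1 l2 a" "in_ideal2 l1 l2 (a * p)"
  shows "in_ideal2 l1 l2 p"
proof -
  obtain j \<mu> where g: "subst (\<lambda>i. Cst (\<mu> i) * Var j) l1 = 0" "subst (\<lambda>i. Cst (\<mu> i) * Var j) l2 = 0"
    "\<And>p. in_ideal2 l1 l2 (p - subst (\<lambda>i. Cst (\<mu> i) * Var j) p)"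
    using common_zero[OF assms(1-4)] by metis
  from in_ideal2_subst[OF g] assms(5,6) show ?thesis by auto
qed

text \<open>This places the \<open>e\<close>-th power of the irrelevant ideal inside
  \<open>(l1, l2, a)\<close>. Modulo \<open>l1, l2\<close> only powers of \<open>Var j\<close>
  survive: \<open>q\<close> restricts to a multiple of \<open>Var j ^ e\<close>, and
  \<open>a\<close> to a nonzero constant times \<open>Var j ^ e\<close>.\<close>

lemma ideal_pow_in_ideal3:
  assumes hom: "homogeneous 1 l1" "homogeneous 1 l2" and ndvd: "\<not> l1 dvd l2" "l1 \<noteq> 0"
    and a: "homogeneous (int e) a" "\<not> in_ideal2 l1 l2 a" and q: "q \<in> ideal_pow irrelevant_ideal e"
  shows "\<exists>t. in_ideal2 l1 l2 (q - t * a)"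
proof -
  obtain j \<mu> where g: "subst (\<lambda>i. Cst (\<mu> i) * Var j) l1 = 0" "subst (\<lambda>i. Cst (\<mu> i) * Var j) l2 = 0"
    "\<And>p. in_ideal2 l1 l2 (p - subst (\<lambda>i. Cst (\<mu> i) * Var j) p)"
    using common_zero[OF assms(1-4)] by metis
  let ?g = "\<lambda>i. Cst (\<mu> i) * Var j"
  have irr: "irrelevant_ideal \<subseteq> {p. Var j dvd subst ?g p}"
    unfolding irrelevant_ideal_def by (rule ideal_gen_subset) auto
  have "ideal_pow irrelevant_ideal n \<subseteq> {p. Var j ^ n dvd subst ?g p}" for n
  proof (induction n)
    case (Suc n)
    have "ideal_pow irrelevant_ideal (Suc n) \<subseteq> {p. Var j ^ Suc n dvd subst ?g p}"
      unfolding ideal_pow.simps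
    proof (rule ideal_gen_subset)
      show "{p * q | p q. p \<in> irrelevant_ideal \<and> q \<in> ideal_pow irrelevant_ideal n}
          \<subseteq> {p. Var j ^ Suc n dvd subst ?g p}"
        using Suc irr by (auto intro!: mult_dvd_mono)
    qed auto
    then show ?case .
  qed simp
  with q obtain u where u: "subst ?g q = Var j ^ e * u" by blast
  obtain \<gamma> where \<gamma>: "subst ?g a = Cst \<gamma> * Var j ^ e"
    using subst_line_homogeneous[OF a(1)] by blast
  have "\<gamma> \<noteq> 0" using \<gamma> a(2) in_ideal2_subst[OF g] by auto
  then have inv: "Cst (inverse \<gamma>) * Cst \<gamma> = 1" by (rule Cst_inverse)
  define t where "t = Cst (inverse \<gamma>) * u"
  have "t * subst ?g a = Cst (inverse \<gamma>) * Cst \<gamma> * subst ?g q"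
    unfolding u \<gamma> t_def by (simp only: mult_ac)
  with inv have "subst ?g q = t * subst ?g a" by simp
  then have "q - t * a = (q - subst ?g q) - t * (a - subst ?g a)"
    by (simp add: algebra_simps)
  also have "\<dots> = (q - subst ?g q) + (- t) * (a - subst ?g a)" by simp
  finally show ?thesis using g(3) in_ideal2_add in_ideal2_mult by metis
qed

section \<open>Depth of the last differential\<close>

lemma sum_lessThan_1: "(\<Sum>i<1::nat. f i) = f 0"
  by (simp add: One_nat_def)

lemma sum_lessThan_3: "(\<Sum>i<3. f i) = f 0 + f 1 + f (2::nat)" for f :: "nat \<Rightarrow> 'a :: comm_monoid_add"
  by (simp add: eval_nat_numeral)

lemma sum_lessThan_4: "(\<Sum>i<4. f i) = f 0 + f 1 + f 2 + f (3::nat)" for f :: "nat \<Rightarrow> 'a :: comm_monoid_add"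
  by (simp add: eval_nat_numeral)

lemma less_3_cases: "i < (3::nat) \<Longrightarrow> i = 0 \<or> i = 1 \<or> i = 2"
  by linarith

text \<open>\<open>R1\<close> and \<open>R2\<close> say that \<open>l1, l2, a\<close> is a regular
  sequence, so its Koszul complex is exact and every relation is a cross product with
  \<open>(a, l1, l2)\<close>. \<open>R2\<close> puts \<open>x\<close> into \<open>(l1, l2)\<close>,
  and \<open>R1\<close> solves for the rest.\<close>

lemma koszul:
  fixes a l1 l2 :: "'r :: idom"
  assumes l1: "l1 \<noteq> 0" and R1: "\<And>p q. l1 * p = l2 * q \<Longrightarrow> l1 dvd q"
    and R2: "\<And>p. in_ideal2 l1 l2 (a * p) \<Longrightarrow> in_ideal2 l1 l2 p"
    and eq: "x * a + y * l1 + z * l2 = 0"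
  obtains t0 t1 t2 where "x = t1 * l2 - t2 * l1" "y = t2 * a - t0 * l2" "z = t0 * l1 - t1 * a"
proof -
  have "a * x = l1 * (- y) + l2 * (- z)"
    using eq by (simp add: eq_neg_iff_add_eq_0 algebra_simps)
  then have "in_ideal2 l1 l2 (a * x)" unfolding in_ideal2_def by blast
  then obtain u t1 where x: "x = l1 * u + l2 * t1" using R2 unfolding in_ideal2_def by blast
  have "l1 * (y + u * a) = l2 * (- (z + t1 * a))"
    using eq unfolding x by (simp add: eq_neg_iff_add_eq_0 algebra_simps)
  then obtain t0 where t0: "- (z + t1 * a) = l1 * t0" using R1 by (metis dvdE)
  with \<open>l1 * (y + u * a) = _\<close> have "l1 * (y + u * a) = l1 * (l2 * t0)" by (simp add: mult.left_commute)
  with l1 have "y + u * a = l2 * t0" by simp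
  then have y: "y = (- u) * a - (- t0) * l2" by (simp add: algebra_simps)
  have z: "z = (- t0) * l1 - t1 * a" using t0 by (simp add: algebra_simps eq_neg_iff_add_eq_0 neg_eq_iff_add_eq_0)
  have "x = t1 * l2 - (- u) * l1" by (simp add: x algebra_simps)
  from that[OF this y z] show thesis .
qed

text \<open>Exactness of \<open>0 \<rightarrow> R \<rightarrow> R\<^sup>3 \<rightarrow> R\<^sup>3 \<rightarrow> R\<close> with differentials the column \<open>v\<close>, the matrix with
  columns \<open>r 0, r 1, r 2\<close>, and the row \<open>D\<close>.\<close>

locale exact_complex =
  fixes D :: "nat \<Rightarrow> 'r :: idom" and r :: "nat \<Rightarrow> nat \<Rightarrow> 'r" and v :: "nat \<Rightarrow> 'r"
  assumes syz: "(\<Sum>i<3. D i * p i) = 0 \<Longrightarrow> \<exists>c. \<forall>i<3. p i = (\<Sum>k<3. c k * r k i)"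
    and D_r: "k < 3 \<Longrightarrow> (\<Sum>i<3. D i * r k i) = 0"
    and v_r: "i < 3 \<Longrightarrow> (\<Sum>k<3. v k * r k i) = 0"
    and ker_r: "(\<And>i. i < 3 \<Longrightarrow> (\<Sum>k<3. c k * r k i) = 0) \<Longrightarrow> \<exists>t. \<forall>k<3. c k = t * v k"
    and v_nonzero: "\<exists>k<3. v k \<noteq> 0"
begin

text \<open>Dividing \<open>v\<close> by \<open>m\<close> leaves it in the kernel of the matrix
  \<open>r\<close>, which consists of the multiples of \<open>v\<close>; a nonzero entry then shows
  that \<open>m\<close> is a unit.\<close>

lemma common_factor_dvd_1:
  assumes v: "\<And>k. k < 3 \<Longrightarrow> v k = m * x k"
  shows "m dvd 1"
proof -
  obtain k where k: "k < 3" "v k \<noteq> 0" using v_nonzero by blast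
  have "m \<noteq> 0" using v k by auto
  have "(\<Sum>k<3. x k * r k i) = 0" if "i < 3" for i
  proof -
    have "m * (\<Sum>k<3. x k * r k i) = (\<Sum>k<3. v k * r k i)"
      by (simp add: sum_distrib_left v mult.assoc)
    with v_r[OF that] \<open>m \<noteq> 0\<close> show ?thesis by simp
  qed
  then obtain t where "\<forall>k<3. x k = t * v k" using ker_r[of x] by blast
  then have "v k * 1 = v k * (m * t)" using v k by (metis mult.commute mult.left_commute mult_1_right)
  then have "1 = m * t" using k(2) by (metis mult_left_cancel)
  then show ?thesis by (rule dvdI)
qed

text \<open>If \<open>v = m1 x + m2 y\<close>, then \<open>r x\<close> and \<open>r y\<close> are multiples \<open>m2 \<gamma>\<close> and \<open>- m1 \<gamma>\<close> of one syzygy \<open>\<gamma>\<close>, which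
  is in turn a combination of the columns of \<open>r\<close>; this rewrites \<open>v\<close> as \<open>(m1 s + m2 t) v\<close>.\<close>

lemma regular_pair_comaximal:
  assumes m1: "m1 \<noteq> 0" and reg: "\<And>p q. m1 * p = m2 * q \<Longrightarrow> m1 dvd q"
    and v: "\<And>k. k < 3 \<Longrightarrow> v k = m1 * x k + m2 * y k"
  shows "\<exists>s t. m1 * s + m2 * t = 1"
proof -
  let ?X = "\<lambda>i. \<Sum>k<3. x k * r k i" and ?Y = "\<lambda>i. \<Sum>k<3. y k * r k i"
  have XY: "m1 * ?X i + m2 * ?Y i = 0" if "i < 3" for i
  proof -
    have "m1 * ?X i + m2 * ?Y i = (\<Sum>k<3. v k * r k i)"
      unfolding sum_distrib_left sum.distrib[symmetric] by (rule sum.cong) (simp_all add: v algebra_simps)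
    with v_r[OF that] show ?thesis by simp
  qed
  have "\<exists>\<gamma>. ?Y i = - (m1 * \<gamma>)" if "i < 3" for i
  proof -
    have "m1 * ?X i = m2 * (- ?Y i)" using XY[OF that] by (simp add: eq_neg_iff_add_eq_0)
    then obtain \<gamma> where "- ?Y i = m1 * \<gamma>" using reg by (metis dvdE)
    then show ?thesis by (metis minus_minus)
  qed
  then obtain \<gamma> where Y: "\<And>i. i < 3 \<Longrightarrow> ?Y i = - (m1 * \<gamma> i)" by metis
  have X: "?X i = m2 * \<gamma> i" if "i < 3" for i
  proof -
    have "m1 * ?X i = m1 * (m2 * \<gamma> i)" using XY[OF that] Y[OF that] by (simp add: algebra_simps)
    with m1 show ?thesis by simp
  qed
  have "m1 * (\<Sum>i<3. D i * \<gamma> i) = - (\<Sum>i<3. D i * ?Y i)"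
    by (simp add: Y sum_distrib_left sum_negf mult.left_commute)
  also have "(\<Sum>i<3. D i * ?Y i) = (\<Sum>k<3. y k * (\<Sum>i<3. D i * r k i))"
    unfolding sum_distrib_left by (subst sum.swap) (simp add: mult.left_commute)
  also have "\<dots> = 0" by (simp add: D_r)
  finally have "(\<Sum>i<3. D i * \<gamma> i) = 0" using m1 by simp
  then obtain \<delta> where \<delta>: "\<And>i. i < 3 \<Longrightarrow> \<gamma> i = (\<Sum>k<3. \<delta> k * r k i)" using syz by blast
  have "(\<Sum>k<3. (x k - m2 * \<delta> k) * r k i) = 0" if "i < 3" for i
    using X[OF that] \<delta>[OF that] by (simp add: sum_lessThan_3 algebra_simps)
  then obtain s where s: "\<forall>k<3. x k - m2 * \<delta> k = s * v k" using ker_r[of "\<lambda>k. x k - m2 * \<delta> k"] by blast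
  have "(\<Sum>k<3. (y k + m1 * \<delta> k) * r k i) = 0" if "i < 3" for i
  proof -
    have "(\<Sum>k<3. (y k + m1 * \<delta> k) * r k i) = ?Y i + m1 * \<gamma> i"
      using \<delta>[OF that] by (simp add: sum_lessThan_3 algebra_simps)
    with Y[OF that] show ?thesis by simp
  qed
  then obtain t where t: "\<forall>k<3. y k + m1 * \<delta> k = t * v k" using ker_r[of "\<lambda>k. y k + m1 * \<delta> k"] by blast
  obtain k where k: "k < 3" "v k \<noteq> 0" using v_nonzero by blast
  have "v k * 1 = m1 * (x k - m2 * \<delta> k) + m2 * (y k + m1 * \<delta> k)"
    using v[OF k(1)] by (simp add: algebra_simps)
  also have "\<dots> = v k * (m1 * s + m2 * t)"
    using s t k(1) by (simp add: algebra_simps)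
  finally have "m1 * s + m2 * t = 1" using k(2) by (metis mult_left_cancel)
  then show ?thesis by blast
qed

text \<open>Lets the two linear entries of \<open>v\<close> exchange roles, so that a statement
  about \<open>v 1\<close> and \<open>v 2\<close> also holds in the other order.\<close>

lemma exact_complex_swap:
  "exact_complex D (r \<circ> Transposition.transpose 1 2) (v \<circ> Transposition.transpose 1 2)"
proof -
  define \<tau> :: "nat \<Rightarrow> nat" where "\<tau> = Transposition.transpose 1 2"
  have \<tau>: "\<tau> 0 = 0" "\<tau> 1 = 2" "\<tau> (Suc 0) = 2" "\<tau> 2 = 1" by (simp_all add: \<tau>_def)
  have \<tau>3: "\<tau> k < 3" "\<tau> (\<tau> k) = k" if "k < 3" for k
    using less_3_cases[OF that] \<tau> by auto
  have sum: "(\<Sum>k<3. f (\<tau> k)) = (\<Sum>k<3. f k)" for f :: "nat \<Rightarrow> 'r"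
    by (simp add: sum_lessThan_3 \<tau> algebra_simps)
  have sum': "(\<Sum>k<3. c k * r (\<tau> k) i) = (\<Sum>k<3. c (\<tau> k) * r k i)" for c i
    by (simp add: sum_lessThan_3 \<tau> algebra_simps)
  show ?thesis
    unfolding \<tau>_def[symmetric] comp_def
  proof
    fix p assume "(\<Sum>i<3. D i * p i) = 0"
    then obtain c where "\<forall>i<3. p i = (\<Sum>k<3. c k * r k i)" using syz by blast
    then have "\<forall>i<3. p i = (\<Sum>k<3. c (\<tau> k) * r (\<tau> k) i)" by (simp add: sum[of "\<lambda>k. c k * r k _"])
    then show "\<exists>c. \<forall>i<3. p i = (\<Sum>k<3. c k * r (\<tau> k) i)" by (rule exI[of _ "\<lambda>k. c (\<tau> k)"])
  next
    fix c assume "\<And>i. i < 3 \<Longrightarrow> (\<Sum>k<3. c k * r (\<tau> k) i) = 0"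
    then obtain t where "\<forall>k<3. c (\<tau> k) = t * v k" using ker_r[of "\<lambda>k. c (\<tau> k)"] by (auto simp: sum')
    then have "\<forall>k<3. c k = t * v (\<tau> k)" using \<tau>3 by metis
    then show "\<exists>t. \<forall>k<3. c k = t * v (\<tau> k)" by blast
  next
    show "\<exists>k<3. v (\<tau> k) \<noteq> 0" using v_nonzero \<tau>3 by metis
  qed (use D_r v_r \<tau>3 sum[of "\<lambda>k. v k * r k _"] in auto)
qed

end

section \<open>The Koszul complex and the mapping cone\<close>

declare One_nat_def [simp del]

text \<open>The regular sequence is taken in the order \<open>v 1\<close>, \<open>v 2\<close>,
  \<open>v 0\<close>: with the two linear forms first, regularity of \<open>v 0\<close> will follow
  from primality of the ideal they generate.\<close>

locale regular_exact_complex = exact_complex D r v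
  for D :: "nat \<Rightarrow> 'r :: idom" and r :: "nat \<Rightarrow> nat \<Rightarrow> 'r" and v :: "nat \<Rightarrow> 'r" +
  assumes v1: "v 1 \<noteq> 0" and v2: "v 2 \<noteq> 0"
    and reg1: "\<And>p q. v 1 * p = v 2 * q \<Longrightarrow> v 1 dvd q"
    and reg2: "\<And>p. in_ideal2 (v 1) (v 2) (v 0 * p) \<Longrightarrow> in_ideal2 (v 1) (v 2) p"
begin

lemma koszul_v:
  assumes "x * v 0 + y * v 1 + z * v 2 = 0"
  shows "\<exists>t0 t1 t2. x = t1 * v 2 - t2 * v 1 \<and> y = t2 * v 0 - t0 * v 2 \<and> z = t0 * v 1 - t1 * v 0"
  by (rule koszul[OF v1 _ _ assms]) (use reg1 reg2 in blast)+

text \<open>By \<open>v_r\<close> the \<open>i\<close>-th entries of the three columns form a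
  relation on \<open>v\<close>, hence a cross product with \<open>v\<close>.\<close>

lemma koszul_columns:
  obtains w :: "nat \<Rightarrow> nat \<Rightarrow> 'r" where
    "\<And>i. i < 3 \<Longrightarrow> r 0 i = w 1 i * v 2 - w 2 i * v 1"
    "\<And>i. i < 3 \<Longrightarrow> r 1 i = w 2 i * v 0 - w 0 i * v 2"
    "\<And>i. i < 3 \<Longrightarrow> r 2 i = w 0 i * v 1 - w 1 i * v 0"
proof -
  have "\<exists>w0 w1 w2. r 0 i = w1 * v 2 - w2 * v 1 \<and> r 1 i = w2 * v 0 - w0 * v 2 \<and> r 2 i = w0 * v 1 - w1 * v 0"
    if "i < 3" for i
  proof -
    have "r 0 i * v 0 + r 1 i * v 1 + r 2 i * v 2 = 0"
      using v_r[OF that] by (simp add: sum_lessThan_3 mult.commute)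
    from koszul_v[OF this] show ?thesis by metis
  qed
  then obtain w0 w1 w2 where w: "\<And>i. i < 3 \<Longrightarrow> r 0 i = w1 i * v 2 - w2 i * v 1 \<and>
      r 1 i = w2 i * v 0 - w0 i * v 2 \<and> r 2 i = w0 i * v 1 - w1 i * v 0"
    by metis
  show thesis
    by (rule that[of "\<lambda>k. if k = 0 then w0 else if k = 1 then w1 else w2"]) (use w in auto)
qed

text \<open>As the columns of \<open>r\<close> are relations on \<open>D\<close>, the vector of the
  products of \<open>D\<close> with the \<open>w k\<close> has zero cross product with
  \<open>v\<close>; regularity makes such a vector a multiple of \<open>v\<close>.\<close>

lemma koszul_columns_factor:
  assumes w: "\<And>i. i < 3 \<Longrightarrow> r 0 i = w 1 i * v 2 - w 2 i * v 1"
    "\<And>i. i < 3 \<Longrightarrow> r 1 i = w 2 i * v 0 - w 0 i * v 2"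
    "\<And>i. i < 3 \<Longrightarrow> r 2 i = w 0 i * v 1 - w 1 i * v 0"
  obtains h where "\<And>k. k < 3 \<Longrightarrow> (\<Sum>i<3. D i * w k i) = h * v k"
proof -
  define g where "g k = (\<Sum>i<3. D i * w k i)" for k
  have e0: "g 1 * v 2 = g 2 * v 1"
    using D_r[of 0] by (simp add: g_def sum_lessThan_3 w algebra_simps)
  have e2: "g 0 * v 1 = g 1 * v 0"
    using D_r[of 2] by (simp add: g_def sum_lessThan_3 w algebra_simps)
  from e0 have "v 1 * g 2 = v 2 * g 1" by (simp add: mult.commute)
  then obtain h where h: "g 1 = h * v 1" using reg1 by (metis dvdE mult.commute)
  with e0 have "(h * v 2) * v 1 = g 2 * v 1" by (simp add: mult_ac)
  with v1 have h2: "g 2 = h * v 2" by simp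
  from h e2 have "g 0 * v 1 = (h * v 0) * v 1" by (simp add: mult_ac)
  with v1 have "g 0 = h * v 0" by simp
  with h h2 have "\<And>k. k < 3 \<Longrightarrow> g k = h * v k" using less_3_cases by metis
  then show thesis using that unfolding g_def by blast
qed

end

text \<open>\<open>w\<close> and \<open>h\<close> are the low-degree components of a chain map that
  lifts multiplication by \<open>h\<close> to the Koszul complex of \<open>v\<close>; in the two top
  degrees it is the identity up to sign. Cancelling these in the mapping cone leaves the relations
  \<open>(w k, - v k)\<close> between \<open>D\<close> and \<open>h\<close>.\<close>

locale mapping_cone = regular_exact_complex D r v
  for D :: "nat \<Rightarrow> 'r :: idom" and r :: "nat \<Rightarrow> nat \<Rightarrow> 'r" and v :: "nat \<Rightarrow> 'r" +
  fixes w :: "nat \<Rightarrow> nat \<Rightarrow> 'r" and h :: 'r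
  assumes r_w: "i < 3 \<Longrightarrow> r 0 i = w 1 i * v 2 - w 2 i * v 1"
    "i < 3 \<Longrightarrow> r 1 i = w 2 i * v 0 - w 0 i * v 2"
    "i < 3 \<Longrightarrow> r 2 i = w 0 i * v 1 - w 1 i * v 0"
    and D_w: "k < 3 \<Longrightarrow> (\<Sum>i<3. D i * w k i) = h * v k"
begin

lemma D_comb: "(\<Sum>k<3. c k * (\<Sum>i<3. D i * w k i)) = (\<Sum>k<3. c k * v k) * h"
  unfolding sum_distrib_right by (rule sum.cong) (simp_all add: D_w mult_ac)

text \<open>With \<open>D_w\<close> this gives \<open>J : h = (v)\<close> for the ideal
  \<open>J\<close> of \<open>D\<close>. Each \<open>v k * p - q * w k\<close> is a relation on
  \<open>D\<close>, and two of these suffice to recover \<open>q\<close>.\<close>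

lemma colon:
  assumes p: "(\<Sum>i<3. D i * p i) = q * h"
  shows "\<exists>c. q = (\<Sum>k<3. c k * v k)"
proof -
  have "\<exists>c. \<forall>i<3. v k * p i - q * w k i = (\<Sum>l<3. c l * r l i)" if k: "k < 3" for k
  proof -
    have "(\<Sum>i<3. D i * (v k * p i - q * w k i)) = v k * (\<Sum>i<3. D i * p i) - q * (\<Sum>i<3. D i * w k i)"
      by (simp add: sum_lessThan_3 algebra_simps)
    also have "\<dots> = 0" by (simp add: p D_w[OF k] mult_ac)
    finally show ?thesis by (rule syz)
  qed
  then obtain c where c: "\<And>k i. k < 3 \<Longrightarrow> i < 3 \<Longrightarrow> v k * p i - q * w k i = (\<Sum>l<3. c k l * r l i)"
    by metis
  \<comment> \<open>Eliminating \<open>p\<close> between \<open>k = 0\<close> and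
    \<open>k = 1\<close> leaves \<open>- q * r 2\<close>, by \<open>r_w\<close>; the summand at
    \<open>l = 2\<close> compensates for it. Entry \<open>2\<close> of the resulting multiple of
    \<open>v\<close> expresses \<open>q\<close>.\<close>
  define e where "e l = v 1 * c 0 l - v 0 * c 1 l + (if l = 2 then q else 0)" for l
  have "(\<Sum>l<3. e l * r l i) = 0" if i: "i < 3" for i
  proof -
    have "(\<Sum>l<3. e l * r l i) = v 1 * (\<Sum>l<3. c 0 l * r l i) - v 0 * (\<Sum>l<3. c 1 l * r l i) + q * r 2 i"
      by (simp add: e_def sum_lessThan_3 algebra_simps)
    also have "\<dots> = v 1 * (v 0 * p i - q * w 0 i) - v 0 * (v 1 * p i - q * w 1 i) + q * r 2 i"
      using c[of 0 i] c[of 1 i] i by simp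
    also have "\<dots> = 0" by (simp add: r_w(3)[OF i] algebra_simps)
    finally show ?thesis .
  qed
  then obtain t where "\<forall>k<3. e k = t * v k" using ker_r[of e] by blast
  then have "e 2 = t * v 2" by simp
  then have "q = c 1 2 * v 0 + (- c 0 2) * v 1 + t * v 2"
    by (simp add: e_def algebra_simps)
  then have "q = (\<Sum>k<3. (if k = 0 then c 1 2 else if k = 1 then - c 0 2 else t) * v k)"
    by (simp add: sum_lessThan_3)
  then show ?thesis
    by (intro exI[of _ "\<lambda>k. if k = 0 then c 1 2 else if k = 1 then - c 0 2 else t"])
qed

text \<open>By \<open>colon\<close>, \<open>- q\<close> is a combination of \<open>v\<close>.
  Subtracting the same combination of the \<open>w k\<close> leaves a relation on \<open>D\<close>
  alone, hence a combination of the columns of \<open>r\<close>, which are themselves combinations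
  of the \<open>w k\<close>.\<close>

lemma kernel:
  assumes pq: "(\<Sum>i<3. D i * p i) + q * h = 0"
  shows "\<exists>c. (\<forall>i<3. p i = (\<Sum>k<3. c k * w k i)) \<and> q = - (\<Sum>k<3. c k * v k)"
proof -
  have "(\<Sum>i<3. D i * p i) = (- q) * h" using pq by (simp add: eq_neg_iff_add_eq_0)
  from colon[OF this] obtain c where c: "- q = (\<Sum>k<3. c k * v k)" by blast
  have "(\<Sum>i<3. D i * (p i - (\<Sum>k<3. c k * w k i)))
      = (\<Sum>i<3. D i * p i) - (\<Sum>k<3. c k * (\<Sum>i<3. D i * w k i))"
    by (simp add: sum_lessThan_3 algebra_simps)
  also have "(\<Sum>k<3. c k * (\<Sum>i<3. D i * w k i)) = (\<Sum>k<3. c k * v k) * h"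
    by (rule D_comb)
  also have "(\<Sum>i<3. D i * p i) - (\<Sum>k<3. c k * v k) * h = 0"
    unfolding c[symmetric] using pq by simp
  finally have "(\<Sum>i<3. D i * (p i - (\<Sum>k<3. c k * w k i))) = 0" .
  from syz[OF this] obtain b where b: "\<And>i. i < 3 \<Longrightarrow> p i - (\<Sum>k<3. c k * w k i) = (\<Sum>k<3. b k * r k i)"
    by blast
  \<comment> \<open>\<open>e\<close> is \<open>c\<close> plus the cross product of \<open>v\<close>
    and \<open>b\<close>. The latter absorbs the columns of \<open>r\<close> and, being orthogonal
    to \<open>v\<close>, does not change the combination of \<open>v\<close>.\<close>
  define e where "e k = (if k = 0 then c 0 + (b 2 * v 1 - b 1 * v 2) else if k = 1 then c 1 + (b 0 * v 2 - b 2 * v 0)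
      else c 2 + (b 1 * v 0 - b 0 * v 1))" for k :: nat
  have "p i = (\<Sum>k<3. e k * w k i)" if i: "i < 3" for i
  proof -
    have "p i = (\<Sum>k<3. c k * w k i) + (\<Sum>k<3. b k * r k i)" using b[OF i] by (simp add: algebra_simps)
    then show ?thesis by (simp add: e_def sum_lessThan_3 r_w[OF i] algebra_simps)
  qed
  moreover have "q = - (\<Sum>k<3. e k * v k)"
  proof -
    have "(\<Sum>k<3. e k * v k) = (\<Sum>k<3. c k * v k)"
      by (simp add: e_def sum_lessThan_3 algebra_simps)
    with c show ?thesis by (metis minus_minus)
  qed
  ultimately show ?thesis by blast
qed

text \<open>The relation on \<open>v\<close> makes \<open>c\<close> a cross product of some
  \<open>t\<close> with \<open>v\<close>. Then \<open>t\<close> lies in the kernel of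
  \<open>r\<close>, so it is a multiple of \<open>v\<close> and the cross product vanishes.\<close>

lemma injective:
  assumes w: "\<And>i. i < 3 \<Longrightarrow> (\<Sum>k<3. c k * w k i) = 0" and v: "(\<Sum>k<3. c k * v k) = 0"
    and k: "k < 3"
  shows "c k = 0"
proof -
  have "c 0 * v 0 + c 1 * v 1 + c 2 * v 2 = 0" using v by (simp add: sum_lessThan_3)
  then obtain t0 t1 t2 where t: "c 0 = t1 * v 2 - t2 * v 1" "c 1 = t2 * v 0 - t0 * v 2" "c 2 = t0 * v 1 - t1 * v 0"
    using koszul_v by metis
  define t where "t k = (if k = 0 then t0 else if k = 1 then t1 else t2)" for k :: nat
  have "(\<Sum>k<3. t k * r k i) = 0" if i: "i < 3" for i
  proof -
    have "(\<Sum>k<3. t k * r k i) = - (\<Sum>k<3. c k * w k i)"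
      by (simp add: t_def sum_lessThan_3 r_w[OF i] t algebra_simps)
    with w[OF i] show ?thesis by simp
  qed
  then obtain s where s: "\<And>k. k < 3 \<Longrightarrow> t k = s * v k" using ker_r[of t] by blast
  have "t0 = s * v 0" "t1 = s * v 1" "t2 = s * v 2"
    using s[of 0] s[of 1] s[of 2] by (simp_all add: t_def)
  with t have "c 0 = 0" "c 1 = 0" "c 2 = 0" by (simp_all add: mult_ac)
  then show ?thesis using less_3_cases[OF k] by auto
qed

text \<open>A Koszul diagram chase for the ideal of \<open>D\<close> and \<open>h\<close>. The lifts
  \<open>(x k, u k)\<close> of \<open>v k * p\<close> differ, after cross-multiplication, by
  relations; these give a Koszul cocycle with values in coefficient vectors. Correcting one lift by
  a coboundary makes it divisible by \<open>v 1\<close>, which cancels.\<close>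

lemma torsion_free:
  assumes "\<And>k. k < 3 \<Longrightarrow> \<exists>x u. v k * p = (\<Sum>i<3. D i * x i) + u * h"
  shows "\<exists>x u. p = (\<Sum>i<3. D i * x i) + u * h"
proof -
  obtain x u where xu: "\<And>k. k < 3 \<Longrightarrow> v k * p = (\<Sum>i<3. D i * x k i) + u k * h"
    using assms by metis
  have ex: "\<exists>e. (\<forall>i<3. v l * x k i - v k * x l i = (\<Sum>j<3. e j * w j i)) \<and> v l * u k - v k * u l = - (\<Sum>j<3. e j * v j)"
    if k: "k < 3" and l: "l < 3" for k l
  proof (rule kernel)
    have "(\<Sum>i<3. D i * (v l * x k i - v k * x l i)) + (v l * u k - v k * u l) * h
        = v l * ((\<Sum>i<3. D i * x k i) + u k * h) - v k * ((\<Sum>i<3. D i * x l i) + u l * h)"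
      by (simp add: sum_lessThan_3 algebra_simps)
    also have "\<dots> = v l * (v k * p) - v k * (v l * p)" by (simp only: xu[OF k] xu[OF l])
    also have "\<dots> = 0" by (simp add: mult.left_commute)
    finally show "(\<Sum>i<3. D i * (v l * x k i - v k * x l i)) + (v l * u k - v k * u l) * h = 0" .
  qed
  obtain e12 where e12: "\<And>i. i < 3 \<Longrightarrow> v 2 * x 1 i - v 1 * x 2 i = (\<Sum>j<3. e12 j * w j i)"
      "v 2 * u 1 - v 1 * u 2 = - (\<Sum>j<3. e12 j * v j)"
    using ex[of 1 2] by auto
  obtain e02 where e02: "\<And>i. i < 3 \<Longrightarrow> v 2 * x 0 i - v 0 * x 2 i = (\<Sum>j<3. e02 j * w j i)"
      "v 2 * u 0 - v 0 * u 2 = - (\<Sum>j<3. e02 j * v j)"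
    using ex[of 0 2] by auto
  obtain e01 where e01: "\<And>i. i < 3 \<Longrightarrow> v 1 * x 0 i - v 0 * x 1 i = (\<Sum>j<3. e01 j * w j i)"
      "v 1 * u 0 - v 0 * u 1 = - (\<Sum>j<3. e01 j * v j)"
    using ex[of 0 1] by auto
  \<comment> \<open>The signed sum of the three differences of lifts cancels identically, and
    \<open>injective\<close> transfers this to their coefficient vectors.\<close>
  have "v 0 * e12 j + (- v 1) * e02 j + v 2 * e01 j = 0" if "j < 3" for j
  proof (rule injective[OF _ _ that])
    fix i :: nat assume i: "i < 3"
    have "(\<Sum>k<3. (v 0 * e12 k + (- v 1) * e02 k + v 2 * e01 k) * w k i)
        = v 0 * (\<Sum>j<3. e12 j * w j i) - v 1 * (\<Sum>j<3. e02 j * w j i) + v 2 * (\<Sum>j<3. e01 j * w j i)"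
      by (simp add: sum_lessThan_3 algebra_simps)
    also have "\<dots> = v 0 * (v 2 * x 1 i - v 1 * x 2 i) - v 1 * (v 2 * x 0 i - v 0 * x 2 i) + v 2 * (v 1 * x 0 i - v 0 * x 1 i)"
      using i by (simp add: e12 e02 e01)
    also have "\<dots> = 0" by (simp add: algebra_simps)
    finally show "(\<Sum>k<3. (v 0 * e12 k + (- v 1) * e02 k + v 2 * e01 k) * w k i) = 0" .
  next
    have "(\<Sum>k<3. (v 0 * e12 k + (- v 1) * e02 k + v 2 * e01 k) * v k)
        = - (v 0 * (- (\<Sum>j<3. e12 j * v j)) - v 1 * (- (\<Sum>j<3. e02 j * v j)) + v 2 * (- (\<Sum>j<3. e01 j * v j)))"
      by (simp add: sum_lessThan_3 algebra_simps)
    also have "\<dots> = - (v 0 * (v 2 * u 1 - v 1 * u 2) - v 1 * (v 2 * u 0 - v 0 * u 2) + v 2 * (v 1 * u 0 - v 0 * u 1))"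
      by (simp add: e12 e02 e01)
    also have "\<dots> = 0" by (simp add: algebra_simps)
    finally show "(\<Sum>k<3. (v 0 * e12 k + (- v 1) * e02 k + v 2 * e01 k) * v k) = 0" .
  qed
  then have "\<exists>s t. e12 j = s * v 2 - t * v 1" if "j < 3" for j
  proof -
    have "e12 j * v 0 + (- e02 j) * v 1 + e01 j * v 2 = 0"
      using \<open>\<And>j. j < 3 \<Longrightarrow> v 0 * e12 j + (- v 1) * e02 j + v 2 * e01 j = 0\<close>[OF that]
      by (simp add: mult.commute)
    from koszul_v[OF this] show ?thesis by metis
  qed
  \<comment> \<open>The cocycle is a coboundary; \<open>s\<close> and \<open>t\<close> are the
    corrections to the lifts of \<open>v 1 * p\<close> and \<open>v 2 * p\<close>.\<close>
  then obtain s t where st: "\<And>j. j < 3 \<Longrightarrow> e12 j = s j * v 2 - t j * v 1" by metis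
  have "v 1 dvd x 1 i - (\<Sum>j<3. s j * w j i)" if i: "i < 3" for i
  proof (rule reg1)
    show "v 1 * (x 2 i - (\<Sum>j<3. t j * w j i)) = v 2 * (x 1 i - (\<Sum>j<3. s j * w j i))"
      using e12(1)[of i] i by (simp add: st sum_lessThan_3 algebra_simps)
  qed
  then have "\<forall>i\<in>{..<3}. \<exists>z. x 1 i - (\<Sum>j<3. s j * w j i) = v 1 * z" by (simp add: dvd_def)
  then obtain y where "\<forall>i\<in>{..<3}. x 1 i - (\<Sum>j<3. s j * w j i) = v 1 * y i" by (rule bchoice[THEN exE])
  then have y: "x 1 i = v 1 * y i + (\<Sum>j<3. s j * w j i)" if "i < 3" for i
    using that by (simp add: diff_eq_eq)
  have "v 1 dvd u 1 + (\<Sum>j<3. s j * v j)"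
  proof (rule reg1)
    show "v 1 * (u 2 + (\<Sum>j<3. t j * v j)) = v 2 * (u 1 + (\<Sum>j<3. s j * v j))"
      using e12(2) by (simp add: st sum_lessThan_3 algebra_simps)
  qed
  then obtain z where "u 1 + (\<Sum>j<3. s j * v j) = v 1 * z" by (rule dvdE)
  then have z: "u 1 = v 1 * z - (\<Sum>j<3. s j * v j)" by (simp add: eq_diff_eq)
  \<comment> \<open>The correction is itself a relation between \<open>D\<close> and
    \<open>h\<close>, so it drops out and only the part divisible by \<open>v 1\<close>
    remains.\<close>
  have "v 1 * p = (\<Sum>i<3. D i * x 1 i) + u 1 * h" using xu[of 1] by simp
  also have "\<dots> = (\<Sum>j<3. s j * (\<Sum>i<3. D i * w j i)) - (\<Sum>j<3. s j * v j) * h + v 1 * ((\<Sum>i<3. D i * y i) + z * h)"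
    by (simp add: y z sum_lessThan_3 algebra_simps)
  also have "(\<Sum>j<3. s j * (\<Sum>i<3. D i * w j i)) = (\<Sum>j<3. s j * v j) * h"
    by (rule D_comb)
  finally have "v 1 * p = v 1 * ((\<Sum>i<3. D i * y i) + z * h)" by simp
  with v1 have "p = (\<Sum>i<3. D i * y i) + z * h" by simp
  then show ?thesis by blast
qed

end

section \<open>Resolutions as families of equations\<close>

lemma mult_mat_vec_index_sum:
  assumes "A \<in> carrier_mat n m" "u \<in> carrier_vec m" "i < n"
  shows "(A *\<^sub>v u) $ i = (\<Sum>j<m. A $$ (i, j) * u $ j)"
  using assms by (simp add: mult_mat_vec_def scalar_prod_def lessThan_atLeast0 row_def)

lemma vec_in_mat_image_iff:
  assumes A: "A \<in> carrier_mat n m"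
  shows "vec n x \<in> mat_image A \<longleftrightarrow> (\<exists>c. \<forall>i<n. x i = (\<Sum>j<m. A $$ (i, j) * c j))"
proof
  assume "vec n x \<in> mat_image A"
  then obtain u where u: "u \<in> carrier_vec m" "vec n x = A *\<^sub>v u"
    using A by (auto simp: mat_image_def)
  have "x i = (\<Sum>j<m. A $$ (i, j) * u $ j)" if "i < n" for i
    using that u(2) mult_mat_vec_index_sum[OF A u(1) that] by (metis index_vec)
  then show "\<exists>c. \<forall>i<n. x i = (\<Sum>j<m. A $$ (i, j) * c j)" by blast
next
  assume "\<exists>c. \<forall>i<n. x i = (\<Sum>j<m. A $$ (i, j) * c j)"
  then obtain c where c: "\<forall>i<n. x i = (\<Sum>j<m. A $$ (i, j) * c j)" by blast
  have "vec n x = A *\<^sub>v vec m c"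
  proof (rule eq_vecI)
    fix i assume "i < dim_vec (A *\<^sub>v vec m c)"
    then have "i < n" using A by simp
    then show "vec n x $ i = (A *\<^sub>v vec m c) $ i"
      using mult_mat_vec_index_sum[OF A vec_carrier \<open>i < n\<close>] c by simp
  qed (use A in simp)
  then show "vec n x \<in> mat_image A" using A by (auto simp: mat_image_def)
qed

lemma vec_in_mat_kernel_iff:
  assumes A: "A \<in> carrier_mat n m"
  shows "vec m x \<in> mat_kernel A \<longleftrightarrow> (\<forall>i<n. (\<Sum>j<m. A $$ (i, j) * x j) = 0)"
proof -
  have "vec m x \<in> mat_kernel A \<longleftrightarrow> (\<forall>i<n. (A *\<^sub>v vec m x) $ i = 0)"
    using A by (auto simp: mat_kernel_def intro!: eq_vecI simp del: index_mult_mat_vec)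
  then show ?thesis using mult_mat_vec_index_sum[OF A vec_carrier] by simp
qed

lemma vec_set_eqI:
  assumes "V \<subseteq> carrier_vec n" "W \<subseteq> carrier_vec n" "\<And>x. vec n x \<in> V \<longleftrightarrow> vec n x \<in> W"
  shows "V = W"
proof -
  have "u \<in> V \<longleftrightarrow> u \<in> W" if "u \<in> carrier_vec n" for u
  proof -
    have "vec n (\<lambda>i. u $ i) = u" using that by (auto intro!: eq_vecI)
    with assms(3)[of "\<lambda>i. u $ i"] show ?thesis by simp
  qed
  then show ?thesis using assms by blast
qed

lemma mat_image_carrier: "A \<in> carrier_mat n m \<Longrightarrow> mat_image A \<subseteq> carrier_vec n"
  by (auto simp: mat_image_def)

text \<open>Minimality is membership of all \<open>G j\<close> and \<open>M i j\<close> in the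
  irrelevant ideal; \<open>I\<close>, \<open>GM\<close>, \<open>ker\<close> and \<open>inj\<close>
  express exactness at the three places.\<close>

lemma minimal_resolution_form_2I:
  fixes G :: "nat \<Rightarrow> S" and M :: "nat \<Rightarrow> nat \<Rightarrow> S"
  assumes n: "length F1 = n" and m: "length F2 = m"
    and G: "\<And>j. j < n \<Longrightarrow> homogeneous (F1 ! j) (G j) \<and> G j \<in> irrelevant_ideal"
    and M: "\<And>i j. i < n \<Longrightarrow> j < m \<Longrightarrow> homogeneous (F2 ! j - F1 ! i) (M i j) \<and> M i j \<in> irrelevant_ideal"
    and I: "\<And>p. p \<in> I \<longleftrightarrow> (\<exists>x. p = (\<Sum>j<n. G j * x j))"
    and GM: "\<And>j. j < m \<Longrightarrow> (\<Sum>i<n. G i * M i j) = 0"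
    and ker: "\<And>x. (\<Sum>i<n. G i * x i) = 0 \<Longrightarrow> \<exists>c. \<forall>i<n. x i = (\<Sum>j<m. M i j * c j)"
    and inj: "\<And>c j. (\<And>i. i < n \<Longrightarrow> (\<Sum>j<m. M i j * c j) = 0) \<Longrightarrow> j < m \<Longrightarrow> c j = 0"
  shows "minimal_resolution_form I [F1, F2]"
proof -
  define A where "A = mat 1 n (\<lambda>(i, j). G j)"
  define B where "B = mat n m (\<lambda>(i, j). M i j)"
  have A: "A \<in> carrier_mat 1 n" and B: "B \<in> carrier_mat n m" by (simp_all add: A_def B_def)
  have AG: "(\<Sum>j<n. A $$ (0, j) * x j) = (\<Sum>j<n. G j * x j)" for x
    by (simp add: A_def)
  have BM: "(\<Sum>j<m. B $$ (i, j) * x j) = (\<Sum>j<m. M i j * x j)" if "i < n" for i x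
    using that by (simp add: B_def)
  have "mat_image A = {v \<in> carrier_vec 1. v $ 0 \<in> I}"
  proof (rule vec_set_eqI[OF mat_image_carrier[OF A]])
    show "vec 1 x \<in> mat_image A \<longleftrightarrow> vec 1 x \<in> {v \<in> carrier_vec 1. v $ 0 \<in> I}" for x
      unfolding vec_in_mat_image_iff[OF A] by (auto simp: AG I)
  qed auto
  moreover have "mat_image B = mat_kernel A"
  proof (rule vec_set_eqI[OF mat_image_carrier[OF B] mat_kernel_carrier[OF A]])
    fix x
    have "(\<Sum>i<n. G i * x i) = 0" if "\<forall>i<n. x i = (\<Sum>j<m. M i j * c j)" for c
    proof -
      have "(\<Sum>i<n. G i * x i) = (\<Sum>i<n. \<Sum>j<m. c j * (G i * M i j))"
        using that by (simp add: sum_distrib_left mult_ac)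
      also have "\<dots> = (\<Sum>j<m. c j * (\<Sum>i<n. G i * M i j))"
        by (subst sum.swap) (simp add: sum_distrib_left)
      also have "\<dots> = 0" by (simp add: GM)
      finally show ?thesis .
    qed
    then show "vec n x \<in> mat_image B \<longleftrightarrow> vec n x \<in> mat_kernel A"
      unfolding vec_in_mat_image_iff[OF B] vec_in_mat_kernel_iff[OF A]
      using ker[of x] by (auto simp: AG BM)
  qed
  moreover have "mat_kernel B = {0\<^sub>v m}"
  proof (rule vec_set_eqI[OF mat_kernel_carrier[OF B]])
    fix x :: "nat \<Rightarrow> S"
    have "vec m x = 0\<^sub>v m \<longleftrightarrow> (\<forall>j<m. x j = 0)"
      by (auto simp: Matrix.vec_eq_iff)
    moreover have "(\<forall>i<n. (\<Sum>j<m. M i j * x j) = 0) \<longleftrightarrow> (\<forall>j<m. x j = 0)"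
    proof
      assume *: "\<forall>i<n. (\<Sum>j<m. M i j * x j) = 0"
      show "\<forall>j<m. x j = 0"
      proof (intro allI impI)
        fix j assume "j < m"
        show "x j = 0" by (rule inj[OF _ \<open>j < m\<close>]) (use * in blast)
      qed
    qed simp
    ultimately show "vec m x \<in> mat_kernel B \<longleftrightarrow> vec m x \<in> {0\<^sub>v m}"
      unfolding vec_in_mat_kernel_iff[OF B] by (simp add: BM)
  qed auto
  moreover have "graded_map F1 [0] A" "graded_map F2 F1 B"
    using G M n m by (auto simp: graded_map_def A_def B_def)
  moreover have "elements_mat A \<subseteq> irrelevant_ideal" "elements_mat B \<subseteq> irrelevant_ideal"
    using G M by (auto simp: elements_mat_def A_def B_def)
  ultimately have "minimal_free_resolution I [F1, F2] [A, B]"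
    unfolding minimal_free_resolution_def
    by (auto simp: m less_Suc_eq numeral_2_eq_2 One_nat_def)
  then show ?thesis unfolding minimal_resolution_form_def by blast
qed

lemma minimal_free_resolution_3D:
  assumes R: "minimal_free_resolution I [F1, F2, F3] [A, B, C]"
    and l: "length F1 = n1" "length F2 = n2" "length F3 = n3"
  shows "\<And>j. j < n1 \<Longrightarrow> homogeneous (F1 ! j) (A $$ (0, j)) \<and> A $$ (0, j) \<in> irrelevant_ideal"
    and "\<And>i j. i < n1 \<Longrightarrow> j < n2 \<Longrightarrow> homogeneous (F2 ! j - F1 ! i) (B $$ (i, j)) \<and> B $$ (i, j) \<in> irrelevant_ideal"
    and "\<And>i j. i < n2 \<Longrightarrow> j < n3 \<Longrightarrow> homogeneous (F3 ! j - F2 ! i) (C $$ (i, j)) \<and> C $$ (i, j) \<in> irrelevant_ideal"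
    and "\<And>p. p \<in> I \<longleftrightarrow> (\<exists>x. p = (\<Sum>j<n1. A $$ (0, j) * x j))"
    and "\<And>x. (\<Sum>j<n1. A $$ (0, j) * x j) = 0 \<longleftrightarrow> (\<exists>c. \<forall>i<n1. x i = (\<Sum>j<n2. B $$ (i, j) * c j))"
    and "\<And>x. (\<forall>i<n1. (\<Sum>j<n2. B $$ (i, j) * x j) = 0) \<longleftrightarrow> (\<exists>c. \<forall>i<n2. x i = (\<Sum>j<n3. C $$ (i, j) * c j))"
    and "\<And>x. (\<forall>i<n2. (\<Sum>j<n3. C $$ (i, j) * x j) = 0) \<Longrightarrow> (\<forall>j<n3. x j = 0)"
proof -
  note R' = R[unfolded minimal_free_resolution_def]
  have gr: "graded_map F1 [0] A" "graded_map F2 F1 B" "graded_map F3 F2 C"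
    using R' by (auto simp: less_Suc_eq_0_disj All_less_Suc2 numeral_3_eq_3)
  have A: "A \<in> carrier_mat 1 n1" and B: "B \<in> carrier_mat n1 n2" and C: "C \<in> carrier_mat n2 n3"
    using gr l by (auto simp: graded_map_def One_nat_def)
  have im: "mat_image A = {v \<in> carrier_vec 1. v $ 0 \<in> I}" "mat_image B = mat_kernel A"
      "mat_image C = mat_kernel B" "mat_kernel C = {0\<^sub>v n3}"
    using R' l by (auto simp: less_Suc_eq_0_disj All_less_Suc2 numeral_3_eq_3)
  have irr: "\<And>i j. i < 1 \<Longrightarrow> j < n1 \<Longrightarrow> A $$ (i, j) \<in> irrelevant_ideal"
      "\<And>i j. i < n1 \<Longrightarrow> j < n2 \<Longrightarrow> B $$ (i, j) \<in> irrelevant_ideal"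
      "\<And>i j. i < n2 \<Longrightarrow> j < n3 \<Longrightarrow> C $$ (i, j) \<in> irrelevant_ideal"
    using R' A B C by (auto simp: elements_mat_def UN_subset_iff image_subset_iff)
  show "\<And>j. j < n1 \<Longrightarrow> homogeneous (F1 ! j) (A $$ (0, j)) \<and> A $$ (0, j) \<in> irrelevant_ideal"
    using gr(1) irr(1)[of 0] l by (auto simp: graded_map_def)
  show "\<And>i j. i < n1 \<Longrightarrow> j < n2 \<Longrightarrow> homogeneous (F2 ! j - F1 ! i) (B $$ (i, j)) \<and> B $$ (i, j) \<in> irrelevant_ideal"
    using gr(2) irr(2) l by (auto simp: graded_map_def)
  show "\<And>i j. i < n2 \<Longrightarrow> j < n3 \<Longrightarrow> homogeneous (F3 ! j - F2 ! i) (C $$ (i, j)) \<and> C $$ (i, j) \<in> irrelevant_ideal"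
    using gr(3) irr(3) l by (auto simp: graded_map_def)
  show "p \<in> I \<longleftrightarrow> (\<exists>x. p = (\<Sum>j<n1. A $$ (0, j) * x j))" for p
    using vec_in_mat_image_iff[OF A, of "\<lambda>_. p"] im(1) by auto
  show "(\<Sum>j<n1. A $$ (0, j) * x j) = 0 \<longleftrightarrow> (\<exists>c. \<forall>i<n1. x i = (\<Sum>j<n2. B $$ (i, j) * c j))" for x
    using vec_in_mat_image_iff[OF B, of x] vec_in_mat_kernel_iff[OF A, of x] im(2) by auto
  show "(\<forall>i<n1. (\<Sum>j<n2. B $$ (i, j) * x j) = 0) \<longleftrightarrow> (\<exists>c. \<forall>i<n2. x i = (\<Sum>j<n3. C $$ (i, j) * c j))" for x
    using vec_in_mat_image_iff[OF C, of x] vec_in_mat_kernel_iff[OF B, of x] im(3) by auto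
  show "\<forall>j<n3. x j = 0" if "\<forall>i<n2. (\<Sum>j<n3. C $$ (i, j) * x j) = 0" for x
  proof -
    have "vec n3 x = 0\<^sub>v n3" using that vec_in_mat_kernel_iff[OF C, of x] im(4) by auto
    then show ?thesis by (metis index_vec index_zero_vec(1))
  qed
qed

section \<open>The saturation of the Jacobian ideal\<close>

lemma not_dvd_1_if_irrelevant: "p \<in> irrelevant_ideal \<Longrightarrow> \<not> p dvd 1"
  using irrelevant_ideal_mult' one_not_in_irrelevant_ideal by (metis dvdE)

text \<open>If \<open>v 2\<close> were a multiple of \<open>v 1\<close>, then \<open>v 0\<close> and
  \<open>v 1\<close> would generate all entries. Either one of them already does, or the prime
  element \<open>v 1\<close> forms a regular pair with \<open>v 0\<close>; both force a unit into
  the irrelevant ideal.\<close>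

lemma exact_complex_not_dvd:
  fixes D v :: "nat \<Rightarrow> S"
  assumes ex: "exact_complex D r v" and irr: "\<And>k. k < 3 \<Longrightarrow> v k \<in> irrelevant_ideal"
    and hom: "homogeneous 1 (v 1)"
  shows "\<not> v 1 dvd v 2"
proof
  interpret exact_complex D r v by (rule ex)
  have irr012: "v 0 \<in> irrelevant_ideal" "v 1 \<in> irrelevant_ideal" by (simp_all add: irr)
  assume "v 1 dvd v 2"
  then obtain c where c: "v 2 = v 1 * c" by (rule dvdE)
  consider (zero) "v 1 = 0" | (dvd) "v 1 dvd v 0" | (reg) "v 1 \<noteq> 0" "\<not> v 1 dvd v 0" by blast
  then show False
  proof cases
    case zero
    have "v k = v 0 * (if k = 0 then 1 else 0)" if "k < 3" for k
      using less_3_cases[OF that] zero c by auto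
    then have "v 0 dvd 1" by (rule common_factor_dvd_1)
    with irr012 show False using not_dvd_1_if_irrelevant by blast
  next
    case dvd
    then obtain b where b: "v 0 = v 1 * b" by (rule dvdE)
    have "v k = v 1 * (if k = 0 then b else if k = 1 then 1 else c)" if "k < 3" for k
      using less_3_cases[OF that] b c by auto
    then have "v 1 dvd 1" by (rule common_factor_dvd_1)
    with irr012 show False using not_dvd_1_if_irrelevant by blast
  next
    case reg
    have "\<exists>s t. v 1 * s + v 0 * t = 1"
    proof (rule regular_pair_comaximal)
      show "v 1 dvd q" if "v 1 * p = v 0 * q" for p q
        using linear_form_prime[OF hom reg(1), of "v 0" q] reg(2) that by (metis dvd_triv_left)
      show "v k = v 1 * (if k = 0 then 0 else if k = 1 then 1 else c) + v 0 * (if k = 0 then 1 else 0)"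
        if "k < 3" for k
        using less_3_cases[OF that] c by auto
    qed (rule reg)
    then obtain s t where "v 1 * s + v 0 * t = 1" by blast
    then show False
      using irr012 irrelevant_ideal_add irrelevant_ideal_mult' one_not_in_irrelevant_ideal by metis
  qed
qed

text \<open>Degrees of entries are differences of consecutive twists; for instance
  \<open>v 0\<close> has degree \<open>(d + d2) - (d + d1 - 1)\<close>.\<close>

locale nearly_free_complex =
  fixes d d1 d2 :: int and D :: "nat \<Rightarrow> S" and r :: "nat \<Rightarrow> nat \<Rightarrow> S" and v :: "nat \<Rightarrow> S"
  assumes d: "3 \<le> d" and d12: "d1 \<le> d2" "d1 + d2 = d"
    and exact: "exact_complex D r v"
    and hom_D: "i < 3 \<Longrightarrow> homogeneous (d - 1) (D i)"
    and hom_r: "i < 3 \<Longrightarrow> homogeneous d1 (r 0 i)" "i < 3 \<Longrightarrow> homogeneous d2 (r 1 i)" "i < 3 \<Longrightarrow> homogeneous d2 (r 2 i)"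
    and hom_v: "homogeneous (d2 - d1 + 1) (v 0)" "homogeneous 1 (v 1)" "homogeneous 1 (v 2)"
    and irr_r: "i < 3 \<Longrightarrow> r 0 i \<in> irrelevant_ideal"
begin

sublocale exact_complex D r v by (rule exact)

lemma irr_v: "k < 3 \<Longrightarrow> v k \<in> irrelevant_ideal"
  using less_3_cases[of k] hom_v d12 homogeneous_in_irrelevant_ideal[of "d2 - d1 + 1" "v 0"]
    homogeneous_in_irrelevant_ideal[of 1] by auto

lemma comb_v_irrelevant: "(\<Sum>k<3. c k * v k) \<in> irrelevant_ideal"
  by (simp add: sum_lessThan_3 irrelevant_ideal_add irrelevant_ideal_mult irr_v)

lemma not_dvd: "\<not> v 1 dvd v 2" "\<not> v 2 dvd v 1"
proof -
  show "\<not> v 1 dvd v 2" using exact_complex_not_dvd[OF exact irr_v hom_v(2)] .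
  define \<tau> :: "nat \<Rightarrow> nat" where "\<tau> = Transposition.transpose 1 2"
  have \<tau>: "\<tau> 0 = 0" "\<tau> 1 = 2" "\<tau> 2 = 1" by (simp_all add: \<tau>_def)
  have "\<not> (v \<circ> \<tau>) 1 dvd (v \<circ> \<tau>) 2"
  proof (rule exact_complex_not_dvd)
    show "exact_complex D (r \<circ> \<tau>) (v \<circ> \<tau>)" unfolding \<tau>_def by (rule exact_complex_swap)
    show "(v \<circ> \<tau>) k \<in> irrelevant_ideal" if "k < 3" for k
      using less_3_cases[OF that] irr_v \<tau> by auto
  qed (simp add: \<tau> hom_v)
  then show "\<not> v 2 dvd v 1" by (simp add: \<tau>)
qed

lemma v_nz: "v 1 \<noteq> 0" "v 2 \<noteq> 0"
  using not_dvd by auto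

lemma reg_v: "v 1 * p = v 2 * q \<Longrightarrow> v 1 dvd q"
  using linear_form_prime[OF hom_v(2) v_nz(1), of "v 2" q] not_dvd(1) by (metis dvd_triv_left)

text \<open>Otherwise all entries of \<open>v\<close> would lie in the ideal of the regular pair
  \<open>v 1\<close>, \<open>v 2\<close>, which \<open>regular_pair_comaximal\<close> makes the unit
  ideal.\<close>

lemma v0_not_in_ideal: "\<not> in_ideal2 (v 1) (v 2) (v 0)"
proof
  assume "in_ideal2 (v 1) (v 2) (v 0)"
  then obtain a b where ab: "v 0 = v 1 * a + v 2 * b" by (auto simp: in_ideal2_def)
  have "\<exists>s t. v 1 * s + v 2 * t = 1"
  proof (rule regular_pair_comaximal[OF v_nz(1) reg_v])
    show "v k = v 1 * (if k = 0 then a else if k = 1 then 1 else 0) + v 2 * (if k = 0 then b else if k = 1 then 0 else 1)"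
      if "k < 3" for k
      using less_3_cases[OF that] ab by auto
  qed
  then obtain s t where st: "v 1 * s + v 2 * t = 1" by blast
  have "v 1 * s + v 2 * t \<in> irrelevant_ideal"
    by (simp add: irr_v irrelevant_ideal_add irrelevant_ideal_mult')
  with st one_not_in_irrelevant_ideal show False by simp
qed

sublocale regular_exact_complex D r v
proof
  show "in_ideal2 (v 1) (v 2) p" if "in_ideal2 (v 1) (v 2) (v 0 * p)" for p
    using linear_forms_prime_ideal[OF hom_v(2,3) not_dvd(1) v_nz(1) v0_not_in_ideal that] .
qed (use v_nz reg_v in blast)+

text \<open>The first column of \<open>r\<close> has entries in the irrelevant ideal and is nonzero:
  a zero column would put a unit vector into the kernel of \<open>r\<close>, and \<open>v 0\<close>
  would be a unit.\<close>

lemma d1_pos: "1 \<le> d1"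
proof -
  have "\<exists>i<3. r 0 i \<noteq> 0"
  proof (rule ccontr)
    assume "\<not> ?thesis"
    then have "(\<Sum>k<3. (if k = 0 then 1 else 0) * r k i) = 0" if "i < 3" for i
      using that by (simp add: sum_lessThan_3)
    from ker_r[OF this] obtain t where "\<forall>k<3. (if k = 0 then 1 else 0) = t * v k" by blast
    then have "1 = t * v 0" by (metis zero_less_numeral)
    then have "v 0 dvd 1" by (metis dvd_triv_right)
    then show False using not_dvd_1_if_irrelevant irr_v[of 0] by simp
  qed
  then show ?thesis using hom_r(1) irr_r homogeneous_irrelevant_pos by blast
qed

text \<open>Since \<open>r\<close> and \<open>v\<close> are homogeneous, the cross product equations
  survive taking components of the expected degrees.\<close>

lemma homogeneous_cone:
  obtains w h where "mapping_cone D r v w h"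
    "\<And>i. i < 3 \<Longrightarrow> homogeneous (d2 - 1) (w 0 i)"
    "\<And>i. i < 3 \<Longrightarrow> homogeneous (d1 - 1) (w 1 i)"
    "\<And>i. i < 3 \<Longrightarrow> homogeneous (d1 - 1) (w 2 i)"
    "homogeneous (d + d1 - 3) h"
proof -
  obtain w' :: "nat \<Rightarrow> nat \<Rightarrow> S" where w': "\<And>i. i < 3 \<Longrightarrow> r 0 i = w' 1 i * v 2 - w' 2 i * v 1"
    "\<And>i. i < 3 \<Longrightarrow> r 1 i = w' 2 i * v 0 - w' 0 i * v 2"
    "\<And>i. i < 3 \<Longrightarrow> r 2 i = w' 0 i * v 1 - w' 1 i * v 0"
    using koszul_columns by blast
  \<comment> \<open>\<open>w 0\<close> times linear forms contributes to the columns of degree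
    \<open>d2\<close>, and \<open>w 1\<close>, \<open>w 2\<close> times linear forms to the column
    of degree \<open>d1\<close>.\<close>
  define w where "w k i = hcomp ((if k = 0 then d2 else d1) - 1) (w' k i)" for k :: nat and i
  have eq: "d2 - (d2 - d1 + 1) = d1 - 1" by simp
  have rw: "r 0 i = w 1 i * v 2 - w 2 i * v 1" "r 1 i = w 2 i * v 0 - w 0 i * v 2" "r 2 i = w 0 i * v 1 - w 1 i * v 0"
    if i: "i < 3" for i
  proof -
    have "r 0 i = hcomp d1 (v 2 * w' 1 i - v 1 * w' 2 i)"
      using hom_r(1)[OF i] w'(1)[OF i] by (simp add: homogeneous_iff_hcomp mult.commute)
    also have "\<dots> = v 2 * hcomp (d1 - 1) (w' 1 i) - v 1 * hcomp (d1 - 1) (w' 2 i)"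
      by (simp only: hcomp_diff hcomp_mult[OF hom_v(2)] hcomp_mult[OF hom_v(3)] eq)
    finally show "r 0 i = w 1 i * v 2 - w 2 i * v 1"
      by (simp add: w_def mult.commute)
    have "r 1 i = hcomp d2 (v 0 * w' 2 i - v 2 * w' 0 i)"
      using hom_r(2)[OF i] w'(2)[OF i] by (simp add: homogeneous_iff_hcomp mult.commute)
    also have "\<dots> = v 0 * hcomp (d1 - 1) (w' 2 i) - v 2 * hcomp (d2 - 1) (w' 0 i)"
      by (simp only: hcomp_diff hcomp_mult[OF hom_v(1)] hcomp_mult[OF hom_v(3)] eq)
    finally show "r 1 i = w 2 i * v 0 - w 0 i * v 2"
      by (simp add: w_def mult.commute)
    have "r 2 i = hcomp d2 (v 1 * w' 0 i - v 0 * w' 1 i)"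
      using hom_r(3)[OF i] w'(3)[OF i] by (simp add: homogeneous_iff_hcomp mult.commute)
    also have "\<dots> = v 1 * hcomp (d2 - 1) (w' 0 i) - v 0 * hcomp (d1 - 1) (w' 1 i)"
      by (simp only: hcomp_diff hcomp_mult[OF hom_v(1)] hcomp_mult[OF hom_v(2)] eq)
    finally show "r 2 i = w 0 i * v 1 - w 1 i * v 0"
      by (simp add: w_def mult.commute)
  qed
  obtain h where h: "\<And>k. k < 3 \<Longrightarrow> (\<Sum>i<3. D i * w k i) = h * v k"
    using koszul_columns_factor[OF rw] by blast
  have hw: "homogeneous ((if k = 0 then d2 else d1) - 1) (w k i)" for k i
    by (simp add: w_def)
  \<comment> \<open>The sum equals \<open>h * v 1\<close> with \<open>v 1\<close> linear, so its
    degree \<open>(d - 1) + (d1 - 1)\<close> is one more than that of \<open>h\<close>.\<close>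
  have "homogeneous (d + d1 - 2) (\<Sum>i<3. D i * w 1 i)"
  proof (rule homogeneous_sum)
    fix i :: nat assume "i \<in> {..<3}"
    then show "homogeneous (d + d1 - 2) (D i * w 1 i)"
      using hw[of 1 i] by (intro homogeneous_mult[OF hom_D]) auto
  qed
  then have "homogeneous (d + d1 - 2) (v 1 * h)" by (simp add: h mult.commute)
  then have "homogeneous (d + d1 - 2 - 1) h" by (rule homogeneous_cancel[OF hom_v(2) v_nz(1)])
  then have hh: "homogeneous (d + d1 - 3) h" by simp
  show thesis
  proof (rule that[of w h])
    show "mapping_cone D r v w h"
      by unfold_locales (use rw h in auto)
  qed (use hw[of 0] hw[of 1] hw[of 2] hh in auto)
qed

end

section \<open>The saturation, generated by \<open>D\<close> and \<open>h\<close>\<close>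

locale nearly_free_cone = nearly_free_complex d d1 d2 D r v + mapping_cone D r v w h
  for d d1 d2 D r v w h +
  assumes hom_w: "i < 3 \<Longrightarrow> homogeneous (d2 - 1) (w 0 i)"
    "i < 3 \<Longrightarrow> homogeneous (d1 - 1) (w 1 i)"
    "i < 3 \<Longrightarrow> homogeneous (d1 - 1) (w 2 i)"
    and hom_h: "homogeneous (d + d1 - 3) h"
begin

text \<open>Otherwise \<open>colon\<close> would put \<open>1\<close> into the proper ideal
  \<open>(v)\<close>.\<close>

lemma h_not_in_J: "h \<noteq> (\<Sum>i<3. D i * x i)"
proof
  assume "h = (\<Sum>i<3. D i * x i)"
  then have "(\<Sum>i<3. D i * x i) = 1 * h" by simp
  then obtain c where "1 = (\<Sum>k<3. c k * v k)" using colon by blast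
  then show False using comb_v_irrelevant one_not_in_irrelevant_ideal by metis
qed

lemma h_nz: "h \<noteq> 0"
  using h_not_in_J[of "\<lambda>_. 0"] by simp

text \<open>The ideal of \<open>D\<close> and \<open>h\<close> is saturated by repeated use of
  \<open>torsion_free\<close>, as the entries of \<open>v\<close> lie in the irrelevant ideal.
  Conversely, some power of the irrelevant ideal lies in \<open>(v)\<close>, and each
  \<open>h * v k\<close> lies in \<open>J\<close>.\<close>

lemma saturation_J:
  assumes J: "\<And>p. p \<in> J \<longleftrightarrow> (\<exists>x. p = (\<Sum>i<3. D i * x i))"
  shows "p \<in> saturation J \<longleftrightarrow> (\<exists>x u. p = (\<Sum>i<3. D i * x i) + u * h)"
proof
  \<comment> \<open>\<open>p\<close> is kept general because the induction passes from
    \<open>p\<close> to the products \<open>v l * p\<close>.\<close>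
  have *: "\<exists>x u. p = (\<Sum>i<3. D i * x i) + u * h"
    if "\<forall>q\<in>ideal_pow irrelevant_ideal k. \<exists>x u. q * p = (\<Sum>i<3. D i * x i) + u * h" for k p
    using that
  proof (induction k arbitrary: p)
    case 0
    from 0[rule_format, of 1] show ?case by simp
  next
    case (Suc k)
    show ?case
    proof (rule torsion_free)
      fix l :: nat assume "l < 3"
      show "\<exists>x u. v l * p = (\<Sum>i<3. D i * x i) + u * h"
      proof (rule Suc.IH, rule ballI)
        fix q assume "q \<in> ideal_pow irrelevant_ideal k"
        then have "v l * q \<in> ideal_pow irrelevant_ideal (Suc k)"
          unfolding ideal_pow.simps ideal_gen_def using irr_v[OF \<open>l < 3\<close>]
          by (intro Modules.module.span_base[OF S_module]) blast
        from Suc.prems[rule_format, OF this]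
        show "\<exists>x u. q * (v l * p) = (\<Sum>i<3. D i * x i) + u * h" by (simp add: mult_ac)
      qed
    qed
  qed
  assume "p \<in> saturation J"
  then obtain k where k: "\<forall>q\<in>ideal_pow irrelevant_ideal k. q * p \<in> J" by (auto simp: saturation_def)
  have "\<exists>x u. q * p = (\<Sum>i<3. D i * x i) + u * h" if "q \<in> ideal_pow irrelevant_ideal k" for q
  proof -
    have "q * p \<in> J" using k that by blast
    then obtain x where "q * p = (\<Sum>i<3. D i * x i)" unfolding J by (elim exE)
    then have "q * p = (\<Sum>i<3. D i * x i) + 0 * h" by simp
    then show ?thesis by blast
  qed
  then show "\<exists>x u. p = (\<Sum>i<3. D i * x i) + u * h" using *[of k p] by blast
next
  assume "\<exists>x u. p = (\<Sum>i<3. D i * x i) + u * h"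
  then obtain x u where p: "p = (\<Sum>i<3. D i * x i) + u * h" by blast
  \<comment> \<open>The degree of \<open>v 0\<close>, an exponent for which the power of the
    irrelevant ideal falls into \<open>(v)\<close>.\<close>
  define e where "e = nat (d2 - d1 + 1)"
  have e: "homogeneous (int e) (v 0)" using hom_v(1) d12 by (simp add: e_def)
  have "q * p \<in> J" if q: "q \<in> ideal_pow irrelevant_ideal e" for q
  proof -
    obtain t where "in_ideal2 (v 1) (v 2) (q - t * v 0)"
      using ideal_pow_in_ideal3[OF hom_v(2,3) not_dvd(1) v_nz(1) e v0_not_in_ideal q] by blast
    then obtain a b where "q - t * v 0 = v 1 * a + v 2 * b" by (auto simp: in_ideal2_def)
    then have q: "q = t * v 0 + a * v 1 + b * v 2" by (simp add: algebra_simps diff_eq_eq)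
    have "q * h = t * (h * v 0) + a * (h * v 1) + b * (h * v 2)"
      unfolding q by (simp add: algebra_simps)
    also have "\<dots> = t * (\<Sum>i<3. D i * w 0 i) + a * (\<Sum>i<3. D i * w 1 i) + b * (\<Sum>i<3. D i * w 2 i)"
      by (simp add: D_w)
    also have "\<dots> = (\<Sum>i<3. D i * (t * w 0 i + a * w 1 i + b * w 2 i))"
      by (simp add: sum_lessThan_3 algebra_simps)
    finally have qh: "q * h = (\<Sum>i<3. D i * (t * w 0 i + a * w 1 i + b * w 2 i))" .
    have "q * p = q * (\<Sum>i<3. D i * x i) + u * (q * h)" unfolding p by (simp add: algebra_simps)
    also have "\<dots> = (\<Sum>i<3. D i * (q * x i + u * (t * w 0 i + a * w 1 i + b * w 2 i)))"
      unfolding qh by (simp add: sum_distrib_left sum.distrib distrib_left mult.left_commute)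
    finally show ?thesis
      unfolding J by (intro exI[of _ "\<lambda>i. q * x i + u * (t * w 0 i + a * w 1 i + b * w 2 i)"])
  qed
  then show "p \<in> saturation J" by (auto simp: saturation_def)
qed

end

section \<open>Graded pieces of a quotient of ideals\<close>

locale quotient_of_ideals =
  fixes I J :: "S set"
  assumes J_0: "0 \<in> J" and J_add: "p \<in> J \<Longrightarrow> q \<in> J \<Longrightarrow> p + q \<in> J" and J_mult: "p \<in> J \<Longrightarrow> q * p \<in> J"
    and I_0: "0 \<in> I" and I_add: "p \<in> I \<Longrightarrow> q \<in> I \<Longrightarrow> p + q \<in> I" and I_mult: "p \<in> I \<Longrightarrow> q * p \<in> I"
begin

lemma J_uminus: "p \<in> J \<Longrightarrow> - p \<in> J"
  using J_mult[of p "- 1"] by simp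

section \<open>Arithmetic of cosets modulo \<open>J\<close>\<close>

lemma coset_eq_iff: "p +o J = q +o J \<longleftrightarrow> p - q \<in> J"
proof
  assume eq: "p +o J = q +o J"
  have "p + 0 \<in> p +o J" using J_0 by (rule set_plus_intro2)
  then have "p \<in> q +o J" using eq by simp
  then show "p - q \<in> J" by (auto simp: elt_set_plus_def)
next
  have sub: "p +o J \<subseteq> q +o J" if "p - q \<in> J" for p q
  proof
    fix x assume "x \<in> p +o J"
    then obtain j where j: "j \<in> J" "x = p + j" by (auto simp: elt_set_plus_def)
    then have "x = q + ((p - q) + j)" by simp
    moreover have "(p - q) + j \<in> J" using that j(1) by (rule J_add)
    ultimately show "x \<in> q +o J" by (metis set_plus_intro2)
  qed
  assume pq: "p - q \<in> J"
  then have "q - p \<in> J" using J_uminus[OF pq] by simp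
  with pq sub show "p +o J = q +o J" by blast
qed

lemma coset_0: "0 +o J = J"
  by (auto simp: elt_set_plus_def)

lemma coset_add: "(p +o J) + (q +o J) = (p + q) +o J"
proof
  show "(p +o J) + (q +o J) \<subseteq> (p + q) +o J"
  proof
    fix x assume "x \<in> (p +o J) + (q +o J)"
    then obtain i j where ij: "i \<in> J" "j \<in> J" "x = (p + i) + (q + j)"
      by (auto simp: elt_set_plus_def set_plus_def)
    then have "x = (p + q) + (i + j)" by (simp add: algebra_simps)
    with J_add[OF ij(1,2)] show "x \<in> (p + q) +o J" by (metis set_plus_intro2)
  qed
  show "(p + q) +o J \<subseteq> (p +o J) + (q +o J)"
  proof
    fix x assume "x \<in> (p + q) +o J"
    then obtain j where j: "j \<in> J" "x = (p + 0) + (q + j)"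
      by (auto simp: elt_set_plus_def algebra_simps)
    with J_0 show "x \<in> (p +o J) + (q +o J)" by (metis set_plus_intro set_plus_intro2)
  qed
qed

lemma coset_smult: "u *o (p +o J) + J = (u * p) +o J"
proof
  show "u *o (p +o J) + J \<subseteq> (u * p) +o J"
  proof
    fix x assume "x \<in> u *o (p +o J) + J"
    then obtain i j where ij: "i \<in> J" "j \<in> J" "x = u * (p + i) + j"
      by (auto simp: elt_set_plus_def elt_set_times_def set_plus_def)
    then have "x = u * p + (u * i + j)" by (simp add: algebra_simps)
    with J_add[OF J_mult[OF ij(1)] ij(2)] show "x \<in> (u * p) +o J" by (metis set_plus_intro2)
  qed
  show "(u * p) +o J \<subseteq> u *o (p +o J) + J"
  proof
    fix x assume "x \<in> (u * p) +o J"
    then obtain j where j: "j \<in> J" "x = u * (p + 0) + j"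
      by (auto simp: elt_set_plus_def)
    with J_0 show "x \<in> u *o (p +o J) + J" by (metis set_plus_intro set_plus_intro2 set_times_intro2)
  qed
qed

section \<open>The graded pieces as complex vector spaces\<close>

definition piece :: "nat \<Rightarrow> S set" where
  "piece k = {p \<in> I. homogeneous (int k) p}"

lemma piece_closed:
  "0 \<in> piece k" "p \<in> piece k \<Longrightarrow> q \<in> piece k \<Longrightarrow> p + q \<in> piece k" "p \<in> piece k \<Longrightarrow> Cst c * p \<in> piece k"
  using I_0 I_add I_mult homogeneous_mult[OF homogeneous_Cst, of "int k" p "int k" c]
  by (auto simp: piece_def homogeneous_add)

lemma quotient_piece_simps:
  "carrier (quotient_piece I J k) = (\<lambda>p. p +o J) ` piece k"
  "zero (quotient_piece I J k) = J"
  "add (quotient_piece I J k) = (+)"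
  "Module.smult (quotient_piece I J k) = (\<lambda>c A. Cst c *o A + J)"
  by (simp_all add: quotient_piece_def piece_def)

lemma vectorspace_quotient_piece: "vectorspace class_ring (quotient_piece I J k)"
proof (rule vectorspace.intro)
  show "field (class_ring :: complex ring)" by (rule class_field.field_axioms)
  show "Module.module (class_ring :: complex ring) (quotient_piece I J k)"
  proof (rule moduleI)
    show "cring (class_ring :: complex ring)" by (rule class_cring.cring_axioms)
    show "abelian_group (quotient_piece I J k)"
    proof (rule abelian_groupI; unfold quotient_piece_simps)
      fix x y assume "x \<in> (\<lambda>p. p +o J) ` piece k" "y \<in> (\<lambda>p. p +o J) ` piece k"
      then show "x + y \<in> (\<lambda>p. p +o J) ` piece k" using piece_closed by (auto simp: coset_add)
    next
      show "J \<in> (\<lambda>p. p +o J) ` piece k" using piece_closed(1) coset_0 by (metis imageI)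
    next
      fix x assume "x \<in> (\<lambda>p. p +o J) ` piece k"
      then obtain p where p: "p \<in> piece k" "x = p +o J" by blast
      have "J + x = (0 +o J) + (p +o J)" by (simp only: coset_0 p)
      also have "\<dots> = x" unfolding coset_add by (simp add: p)
      finally show "J + x = x" .
      have "((Cst (- 1) * p) +o J) + x = (Cst (- 1) * p + p) +o J" by (simp only: p coset_add)
      also have "\<dots> = J" by (simp add: coset_0)
      finally show "\<exists>y\<in>(\<lambda>p. p +o J) ` piece k. y + x = J" using piece_closed(3)[OF p(1)] by blast
    qed (rule add.assoc, rule add.commute)
  qed (auto simp: quotient_piece_simps coset_add coset_add[of _ 0, unfolded coset_0] coset_smult piece_closed distrib_left distrib_right mult.assoc)
qed

text \<open>The dimension is the least size of a finite spanning set, and the empty set spans the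
  zero space.\<close>

lemma dim_quotient_piece_eq_0:
  assumes "piece k \<subseteq> J"
  shows "vectorspace.dim class_ring (quotient_piece I J k) = 0"
proof -
  let ?V = "quotient_piece I J k"
  interpret V: vectorspace "class_ring :: complex ring" ?V by (rule vectorspace_quotient_piece)
  have "carrier ?V \<subseteq> {J}"
    using assms coset_eq_iff[of _ 0] by (auto simp: quotient_piece_simps coset_0)
  moreover have "J \<in> carrier ?V" using V.M.zero_closed by (simp add: quotient_piece_simps)
  ultimately have "V.span {} = carrier ?V"
    using V.span_empty by (auto simp: quotient_piece_simps)
  then have "V.dim \<le> card ({} :: S set set)"
    unfolding V.dim_def by (intro Least_le) auto
  then show ?thesis by simp
qed

text \<open>The coset of \<open>h\<close> spans, so the minimum defining the dimension is attained.
  Dimension zero would then mean that the empty set spans, which puts \<open>h\<close> into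
  \<open>J\<close>.\<close>

lemma dim_quotient_piece_neq_0:
  assumes h: "h \<in> piece k" "h \<notin> J" and gen: "\<And>p. p \<in> piece k \<Longrightarrow> \<exists>c. p - Cst c * h \<in> J"
  shows "vectorspace.dim class_ring (quotient_piece I J k) \<noteq> 0"
proof -
  let ?V = "quotient_piece I J k"
  interpret V: vectorspace "class_ring :: complex ring" ?V by (rule vectorspace_quotient_piece)
  let ?h = "h +o J"
  have h_V: "?h \<in> carrier ?V" using h by (simp add: quotient_piece_simps)
  have "x \<in> V.span {?h}" if x: "x \<in> carrier ?V" for x
  proof -
    obtain p where p: "p \<in> piece k" "x = p +o J" using x[unfolded quotient_piece_simps] by blast
    then obtain c where "p - Cst c * h \<in> J" using gen by blast
    then have "x = c \<odot>\<^bsub>?V\<^esub> ?h" using coset_eq_iff by (simp add: quotient_piece_simps coset_smult p)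
    moreover have "V.lincomb (\<lambda>_. c) {?h} = c \<odot>\<^bsub>?V\<^esub> ?h"
      using V.smult_closed[of c ?h] h_V by (simp add: V.lincomb_def)
    ultimately show ?thesis unfolding V.span_def by (auto intro!: exI[of _ "\<lambda>_. c"] exI[of _ "{?h}"])
  qed
  then have gen_h: "V.span {?h} = carrier ?V"
    using V.span_is_subset2[of "{?h}"] h_V by auto
  let ?P = "\<lambda>n. \<exists>A. finite A \<and> card A = n \<and> A \<subseteq> carrier ?V \<and> V.span A = carrier ?V"
  have "?P (card {?h})" using gen_h h_V by (intro exI[of _ "{?h}"]) auto
  then have "?P V.dim" unfolding V.dim_def by (rule LeastI)
  show ?thesis
  proof
    assume "V.dim = 0"
    with \<open>?P V.dim\<close> have "V.span {} = carrier ?V" by auto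
    then have "?h = J" using h_V V.span_empty by (auto simp: quotient_piece_simps)
    then have "?h = 0 +o J" by (simp add: coset_0)
    with h(2) show False unfolding coset_eq_iff by simp
  qed
qed

end

section \<open>The resolutions of the saturation\<close>

lemma third_index_less_3:
  fixes f :: "nat \<Rightarrow> 'a :: comm_monoid_add"
  assumes "j < 3" "k < 3" "j \<noteq> k"
  obtains n where "n < 3" "n \<noteq> j" "n \<noteq> k" "\<And>i. i < 3 \<Longrightarrow> i = n \<or> i = j \<or> i = k"
    "\<And>f :: nat \<Rightarrow> 'a. (\<Sum>i<3. f i) = f n + f j + f k"
proof -
  have "card {j, k} < card {..<3::nat}" using assms by simp
  then obtain n where n: "n < 3" "n \<noteq> j" "n \<noteq> k"
    by (metis card_mono finite.emptyI finite_insert insertCI lessThan_iff not_le subsetI)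
  have set: "{..<3} = {n, j, k}"
    using n assms by (intro card_subset_eq[symmetric]) auto
  then have "\<And>i. i < 3 \<Longrightarrow> i = n \<or> i = j \<or> i = k" by blast
  moreover have "(\<Sum>i<3. f i) = f n + f j + f k" for f :: "nat \<Rightarrow> 'a"
    unfolding set using n assms by (simp add: add.assoc)
  ultimately show thesis using that n by blast
qed

context nearly_free_cone
begin

text \<open>The generators are homogeneous, so the coefficients can be chosen homogeneous as
  well.\<close>

lemma homogeneous_part:
  assumes p: "homogeneous k p" "p = (\<Sum>i<3. D i * x i) + u * h"
  shows "p = (\<Sum>i<3. D i * hcomp (k - (d - 1)) (x i)) + hcomp (k - (d + d1 - 3)) u * h"
proof -
  have "p = hcomp k p" using p(1) by (simp add: homogeneous_iff_hcomp)
  also have "\<dots> = (\<Sum>i<3. hcomp k (D i * x i)) + hcomp k (h * u)"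
    by (simp only: p(2) hcomp_add hcomp_sum mult.commute[of u])
  also have "(\<Sum>i<3. hcomp k (D i * x i)) = (\<Sum>i<3. D i * hcomp (k - (d - 1)) (x i))"
    by (intro sum.cong refl hcomp_mult[OF hom_D]) simp
  also have "hcomp k (h * u) = hcomp (k - (d + d1 - 3)) u * h"
    by (simp only: hcomp_mult[OF hom_h] mult.commute)
  finally show ?thesis .
qed

text \<open>Below the degree of \<open>h\<close> the coefficient of \<open>h\<close> has negative
  degree and vanishes, so nothing is added to \<open>J\<close>. In the degree of \<open>h\<close>
  that coefficient is a constant, so \<open>h\<close>, which is not in \<open>J\<close>, spans the
  piece.\<close>

lemma sigma_C_eq:
  assumes J: "\<And>p. p \<in> jacobian_ideal f \<longleftrightarrow> (\<exists>x. p = (\<Sum>i<3. D i * x i))"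
  shows "int (sigma_C f) = d + d1 - 3"
proof -
  let ?J = "jacobian_ideal f" and ?I = "saturated_jacobian_ideal f"
  have I: "p \<in> ?I \<longleftrightarrow> (\<exists>x u. p = (\<Sum>i<3. D i * x i) + u * h)" for p
    unfolding saturated_jacobian_ideal_def by (rule saturation_J[OF J])
  interpret Q: quotient_of_ideals ?I ?J
  proof
    show "0 \<in> ?J" unfolding J by (intro exI[of _ "\<lambda>_. 0"]) simp
    show "p + q \<in> ?J" if "p \<in> ?J" "q \<in> ?J" for p q
      using that unfolding jacobian_ideal_def by (rule ideal_gen_add)
    show "q * p \<in> ?J" if "p \<in> ?J" for p q
      using that unfolding jacobian_ideal_def by (rule ideal_gen_mult)
    show "0 \<in> ?I" unfolding I by (intro exI[of _ "\<lambda>_. 0"] exI[of _ 0]) simp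
    show "p + q \<in> ?I" if pq: "p \<in> ?I" "q \<in> ?I" for p q
    proof -
      obtain x u where p: "p = (\<Sum>i<3. D i * x i) + u * h" using pq(1) I by blast
      obtain y t where q: "q = (\<Sum>i<3. D i * y i) + t * h" using pq(2) I by blast
      have "p + q = (\<Sum>i<3. D i * (x i + y i)) + (u + t) * h"
        by (simp add: p q distrib_left distrib_right sum.distrib)
      then show ?thesis unfolding I by (intro exI[of _ "\<lambda>i. x i + y i"] exI[of _ "u + t"])
    qed
    show "q * p \<in> ?I" if pI: "p \<in> ?I" for p q
    proof -
      obtain x u where p: "p = (\<Sum>i<3. D i * x i) + u * h" using pI I by blast
      have "q * p = (\<Sum>i<3. D i * (q * x i)) + (q * u) * h"
        by (simp add: p distrib_left sum_distrib_left mult.left_commute mult.assoc)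
      then show ?thesis unfolding I by (intro exI[of _ "\<lambda>i. q * x i"] exI[of _ "q * u"])
    qed
  qed
  define s where "s = nat (d + d1 - 3)"
  have s: "int s = d + d1 - 3" using d d1_pos by (simp add: s_def)
  have dim: "dim_N f k = vectorspace.dim class_ring (quotient_piece ?I ?J k)" for k
    by (simp add: dim_N_def N_piece_def)
  have "dim_N f k = 0" if "k < s" for k
    unfolding dim
  proof (rule Q.dim_quotient_piece_eq_0)
    show "Q.piece k \<subseteq> ?J"
    proof
      fix p assume "p \<in> Q.piece k"
      then have p: "p \<in> ?I" "homogeneous (int k) p" by (simp_all add: Q.piece_def)
      from p(1) obtain x u where xu: "p = (\<Sum>i<3. D i * x i) + u * h" unfolding I by (elim exE)
      have "hcomp (int k - int s) u = 0" using that by (intro hcomp_neg) simp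
      then have "p = (\<Sum>i<3. D i * hcomp (int k - (d - 1)) (x i))"
        using homogeneous_part[OF p(2) xu] by (simp add: s)
      then show "p \<in> ?J" unfolding J by (intro exI)
    qed
  qed
  moreover have "dim_N f s \<noteq> 0"
    unfolding dim
  proof (rule Q.dim_quotient_piece_neq_0)
    have "h = (\<Sum>i<3. D i * 0) + 1 * h" by simp
    then have "h \<in> ?I" unfolding I by (intro exI[of _ "\<lambda>_. 0"] exI[of _ 1])
    then show "h \<in> Q.piece s" using hom_h by (simp add: Q.piece_def s)
    show "h \<notin> ?J" unfolding J using h_not_in_J by blast
    fix p assume "p \<in> Q.piece s"
    then have p: "p \<in> ?I" "homogeneous (int s) p" by (simp_all add: Q.piece_def)
    from p(1) obtain x u where xu: "p = (\<Sum>i<3. D i * x i) + u * h" unfolding I by (elim exE)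
    have "hcomp (int s - (d + d1 - 3)) u = Cst (Poly_Mapping.lookup (hcomp 0 u) 0)"
      unfolding s using homogeneous_0_Cst[OF homogeneous_hcomp, of u] by simp
    with homogeneous_part[OF p(2) xu] have eq: "p = (\<Sum>i<3. D i * hcomp (int s - (d - 1)) (x i))
        + Cst (Poly_Mapping.lookup (hcomp 0 u) 0) * h"
      by (simp only:)
    have "p - Cst (Poly_Mapping.lookup (hcomp 0 u) 0) * h = (\<Sum>i<3. D i * hcomp (int s - (d - 1)) (x i))"
      unfolding diff_eq_eq by (rule eq)
    then have "p - Cst (Poly_Mapping.lookup (hcomp 0 u) 0) * h \<in> ?J"
      unfolding J by (intro exI)
    then show "\<exists>c. p - Cst c * h \<in> ?J" by (rule exI)
  qed
  ultimately have "sigma_C f = s"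
    unfolding sigma_C_def by (intro Least_equality) (auto simp: not_less[symmetric])
  then show ?thesis by (simp add: s)
qed

text \<open>\<open>kernel\<close> and \<open>injective\<close> give exactness. For
  \<open>2 \<le> d1\<close> the entries of \<open>w 1\<close> and \<open>w 2\<close> have positive
  degree, which makes the resolution minimal.\<close>

lemma resolution_general:
  assumes J: "\<And>p. p \<in> J \<longleftrightarrow> (\<exists>x. p = (\<Sum>i<3. D i * x i))" and d1: "2 \<le> d1"
  shows "minimal_resolution_form (saturation J)
    [[d - 1, d - 1, d - 1, d + d1 - 3], [d + d1 - 2, d + d1 - 2, d + d2 - 2]]"
proof -
  let ?F1 = "[d - 1, d - 1, d - 1, d + d1 - 3]" and ?F2 = "[d + d1 - 2, d + d1 - 2, d + d2 - 2]"
  \<comment> \<open>\<open>\<pi>\<close> moves the relation \<open>(w 0, - v 0)\<close>, of degree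
    \<open>d + d2 - 2\<close>, to the last place to match the order of the twists;
    \<open>\<rho>\<close> is its inverse.\<close>
  define \<pi> :: "nat \<Rightarrow> nat" where "\<pi> j = (if j = 0 then 1 else if j = 1 then 2 else 0)" for j
  define \<rho> :: "nat \<Rightarrow> nat" where "\<rho> k = (if k = 0 then 2 else if k = 1 then 0 else 1)" for k
  have \<pi>: "\<pi> 0 = 1" "\<pi> 1 = 2" "\<pi> 2 = 0" and \<rho>: "\<rho> 0 = 2" "\<rho> 1 = 0" "\<rho> 2 = 1"
    by (simp_all add: \<pi>_def \<rho>_def)
  \<comment> \<open>Index \<open>3\<close> stands for the generator \<open>h\<close>, in
    \<open>G\<close> as in the rows of \<open>M\<close>.\<close>
  define G where "G j = (if j = 3 then h else D j)" for j :: nat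
  define M where "M i j = (if i = 3 then - v (\<pi> j) else w (\<pi> j) i)" for i j :: nat
  have lt4: "i = 0 \<or> i = 1 \<or> i = 2 \<or> i = 3" if "i < 4" for i :: nat using that by linarith
  have GS: "(\<Sum>i<4. G i * x i) = (\<Sum>i<3. D i * x i) + x 3 * h" for x
    by (simp add: G_def sum_lessThan_3 sum_lessThan_4)
  have sum_\<pi>: "(\<Sum>j<3. f (\<pi> j) * c j) = (\<Sum>k<3. c (\<rho> k) * f k)" for f c :: "nat \<Rightarrow> S"
    by (simp add: sum_lessThan_3 \<pi> \<rho> algebra_simps)
  have sum_\<rho>: "(\<Sum>j<3. f (\<pi> j) * c (\<pi> j)) = (\<Sum>k<3. c k * f k)" for f c :: "nat \<Rightarrow> S"
    by (simp add: sum_lessThan_3 \<pi> algebra_simps)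
  show ?thesis
  proof (rule minimal_resolution_form_2I[where n = 4 and m = 3 and G = G and M = M])
    show "length ?F1 = 4" "length ?F2 = 3" by simp_all
    show "homogeneous (?F1 ! j) (G j) \<and> G j \<in> irrelevant_ideal" if "j < 4" for j
    proof -
      have "homogeneous (?F1 ! j) (G j) \<and> 1 \<le> ?F1 ! j"
        using lt4[OF that] hom_D hom_h d d1 by (auto simp: G_def nth_Cons')
      then show ?thesis using homogeneous_in_irrelevant_ideal by blast
    qed
    show "homogeneous (?F2 ! j - ?F1 ! i) (M i j) \<and> M i j \<in> irrelevant_ideal" if ij: "i < 4" "j < 3" for i j
    proof -
      have "homogeneous (?F2 ! j - ?F1 ! i) (M i j) \<and> 1 \<le> ?F2 ! j - ?F1 ! i"
      proof (cases "i = 3")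
        case True
        have "homogeneous (?F2 ! j - (d + d1 - 3)) (v (\<pi> j))"
          using less_3_cases[OF ij(2)] hom_v by (auto simp: \<pi> nth_Cons' algebra_simps)
        then show ?thesis
          using less_3_cases[OF ij(2)] True d12 by (auto simp: M_def homogeneous_uminus nth_Cons')
      next
        case False
        then have i: "i < 3" using ij by simp
        have F1: "?F1 ! i = d - 1" using less_3_cases[OF i] by (auto simp: nth_Cons')
        have "homogeneous (?F2 ! j - (d - 1)) (w (\<pi> j) i)"
          using less_3_cases[OF ij(2)] hom_w[OF i] by (auto simp: \<pi> nth_Cons' algebra_simps)
        then show ?thesis
          using less_3_cases[OF ij(2)] False d12 d1 F1 by (auto simp: M_def nth_Cons')
      qed
      then show ?thesis using homogeneous_in_irrelevant_ideal by blast
    qed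
    show "p \<in> saturation J \<longleftrightarrow> (\<exists>x. p = (\<Sum>i<4. G i * x i))" for p
    proof
      assume "p \<in> saturation J"
      then obtain x u where "p = (\<Sum>i<3. D i * x i) + u * h" unfolding saturation_J[OF J] by (elim exE)
      then have "p = (\<Sum>i<4. G i * (x(3 := u)) i)" unfolding GS by (simp add: sum_lessThan_3)
      then show "\<exists>x. p = (\<Sum>i<4. G i * x i)" by (intro exI)
    next
      assume "\<exists>x. p = (\<Sum>i<4. G i * x i)"
      then show "p \<in> saturation J" unfolding saturation_J[OF J] GS by blast
    qed
    show "(\<Sum>i<4. G i * M i j) = 0" if "j < 3" for j
    proof -
      have "\<pi> j < 3" by (simp add: \<pi>_def)
      have "(\<Sum>i<4. G i * M i j) = (\<Sum>i<3. D i * w (\<pi> j) i) - v (\<pi> j) * h"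
        unfolding GS by (simp add: M_def sum_lessThan_3)
      with D_w[OF \<open>\<pi> j < 3\<close>] show ?thesis by (simp add: mult.commute)
    qed
    show "\<exists>c. \<forall>i<4. x i = (\<Sum>j<3. M i j * c j)" if x: "(\<Sum>i<4. G i * x i) = 0" for x
    proof -
      from kernel[OF x[unfolded GS]] obtain c where c: "\<And>i. i < 3 \<Longrightarrow> x i = (\<Sum>k<3. c k * w k i)" "x 3 = - (\<Sum>k<3. c k * v k)"
        by blast
      have xi: "x i = (\<Sum>j<3. M i j * c (\<pi> j))" if "i < 4" for i
      proof (cases "i = 3")
        case True
        then show ?thesis using sum_\<rho>[of v c] by (simp add: M_def c(2) sum_negf)
      next
        case False
        then show ?thesis using sum_\<rho>[of "\<lambda>k. w k i" c] that by (simp add: M_def c(1))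
      qed
      show ?thesis by (intro exI[of _ "\<lambda>j. c (\<pi> j)"] allI impI) (rule xi)
    qed
    show "c j = 0" if z: "\<And>i. i < 4 \<Longrightarrow> (\<Sum>j<3. M i j * c j) = 0" and j: "j < 3" for c j
    proof -
      have "(\<Sum>k<3. c (\<rho> k) * w k i) = 0" if "i < 3" for i
        using z[of i] that sum_\<pi>[of "\<lambda>k. w k i" c] by (simp add: M_def)
      moreover have "(\<Sum>k<3. c (\<rho> k) * v k) = 0"
        using z[of 3] sum_\<pi>[of v c] by (simp add: M_def sum_negf)
      ultimately have "c (\<rho> k) = 0" if "k < 3" for k
        using injective[of "\<lambda>k. c (\<rho> k)"] that by blast
      from this[of 0] this[of 1] this[of 2] show ?thesis using less_3_cases[OF j] by (auto simp: \<rho>)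
    qed
  qed
qed

text \<open>For \<open>d1 = 1\<close> the vectors \<open>w 1\<close> and \<open>w 2\<close> are
  constant. Being independent, they express two of the partial derivatives by the third,
  \<open>D n\<close>, and by \<open>h\<close>, which leaves a single relation.\<close>

lemma resolution_complete_intersection:
  assumes J: "\<And>p. p \<in> J \<longleftrightarrow> (\<exists>x. p = (\<Sum>i<3. D i * x i))" and d1: "d1 = 1"
  shows "minimal_resolution_form (saturation J) [[d - 1, d - 2], [2 * d - 3]]"
proof -
  define a where "a i = Poly_Mapping.lookup (w 1 i) 0" for i
  define b where "b i = Poly_Mapping.lookup (w 2 i) 0" for i
  have w: "w 1 i = Cst (a i)" "w 2 i = Cst (b i)" if "i < 3" for i
    unfolding a_def b_def using hom_w(2,3)[OF that] d1 by (auto intro!: homogeneous_0_Cst)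
  \<comment> \<open>Were \<open>w 1\<close> and \<open>w 2\<close> dependent, cancelling
    \<open>h\<close> in \<open>D_w\<close> would make \<open>v 2\<close> a multiple of
    \<open>v 1\<close>.\<close>
  have "\<exists>j<3. \<exists>k<3. a j * b k \<noteq> a k * b j"
  proof (rule ccontr)
    assume "\<not> ?thesis"
    then have ab: "a j * b k = a k * b j" if "j < 3" "k < 3" for j k using that by blast
    have vw: "Cst (b k) * v 1 = Cst (a k) * v 2" if k: "k < 3" for k
    proof -
      have "h * (Cst (b k) * v 1) = Cst (b k) * (\<Sum>i<3. D i * w 1 i)"
        by (simp add: D_w mult_ac)
      also have "\<dots> = (\<Sum>i<3. D i * Cst (a i * b k))"
        by (simp add: w sum_lessThan_3 algebra_simps)
      also have "\<dots> = (\<Sum>i<3. D i * Cst (a k * b i))"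
        using ab k by (intro sum.cong) simp_all
      also have "\<dots> = Cst (a k) * (\<Sum>i<3. D i * w 2 i)"
        by (simp add: w sum_lessThan_3 algebra_simps)
      also have "\<dots> = h * (Cst (a k) * v 2)"
        by (simp add: D_w mult_ac)
      finally show ?thesis using h_nz by simp
    qed
    have "\<exists>k<3. a k \<noteq> 0"
    proof (rule ccontr)
      assume "\<not> ?thesis"
      then have "h * v 1 = 0" using D_w[of 1] by (simp add: w sum_lessThan_3)
      with h_nz v_nz show False by simp
    qed
    then obtain k where k: "k < 3" "a k \<noteq> 0" by blast
    have "v 2 = Cst (inverse (a k)) * (Cst (a k) * v 2)"
      using Cst_inverse(2)[OF k(2)] by (simp add: mult.assoc[symmetric])
    also have "\<dots> = v 1 * (Cst (inverse (a k)) * Cst (b k))"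
      unfolding vw[OF k(1), symmetric] by (simp only: mult_ac)
    finally show False using not_dvd(1) by (metis dvd_triv_left)
  qed
  then obtain j k where jk: "j < 3" "k < 3" "a j * b k \<noteq> a k * b j" by blast
  then have "j \<noteq> k" by auto
  then obtain n where n: "n < 3" "n \<noteq> j" "n \<noteq> k" "\<And>i. i < 3 \<Longrightarrow> i = n \<or> i = j \<or> i = k"
    and sum: "\<And>f :: nat \<Rightarrow> S. (\<Sum>i<3. f i) = f n + f j + f k"
    using third_index_less_3[OF jk(1,2), where 'a = S] by metis
  define \<delta> where "\<delta> = Cst (inverse (a j * b k - a k * b j))"
  have "Cst (a j * b k - a k * b j) * \<delta> = 1"
    unfolding \<delta>_def using jk(3) by (intro Cst_inverse) simp
  then have \<delta>: "(Cst (a j) * Cst (b k) - Cst (a k) * Cst (b j)) * \<delta> = 1" by simp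
  \<comment> \<open>By Cramer's rule, \<open>\<alpha> p\<close>, \<open>\<beta> p\<close> and
    \<open>\<gamma> p\<close> are the coordinates of \<open>p\<close> in the basis formed by the
    \<open>n\<close>-th unit vector, \<open>w 1\<close> and \<open>w 2\<close>.\<close>
  define \<beta> where "\<beta> p = (p j * Cst (b k) - p k * Cst (b j)) * \<delta>" for p :: "nat \<Rightarrow> S"
  define \<gamma> where "\<gamma> p = (Cst (a j) * p k - Cst (a k) * p j) * \<delta>" for p :: "nat \<Rightarrow> S"
  define \<alpha> where "\<alpha> p = p n - \<beta> p * Cst (a n) - \<gamma> p * Cst (b n)" for p :: "nat \<Rightarrow> S"
  have basis: "\<beta> p * Cst (a j) + \<gamma> p * Cst (b j) = p j" "\<beta> p * Cst (a k) + \<gamma> p * Cst (b k) = p k"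
    "\<alpha> p + \<beta> p * Cst (a n) + \<gamma> p * Cst (b n) = p n" for p
  proof -
    have "\<beta> p * Cst (a j) + \<gamma> p * Cst (b j) = ((Cst (a j) * Cst (b k) - Cst (a k) * Cst (b j)) * \<delta>) * p j"
      by (simp add: \<beta>_def \<gamma>_def algebra_simps)
    then show "\<beta> p * Cst (a j) + \<gamma> p * Cst (b j) = p j" unfolding \<delta> by simp
    have "\<beta> p * Cst (a k) + \<gamma> p * Cst (b k) = ((Cst (a j) * Cst (b k) - Cst (a k) * Cst (b j)) * \<delta>) * p k"
      by (simp add: \<beta>_def \<gamma>_def algebra_simps)
    then show "\<beta> p * Cst (a k) + \<gamma> p * Cst (b k) = p k" unfolding \<delta> by simp
  qed (simp add: \<alpha>_def)
  have D_basis: "(\<Sum>i<3. D i * p i) = D n * \<alpha> p + h * (\<beta> p * v 1 + \<gamma> p * v 2)" for p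
  proof -
    have "(\<Sum>i<3. D i * p i) = D n * \<alpha> p + \<beta> p * (\<Sum>i<3. D i * w 1 i) + \<gamma> p * (\<Sum>i<3. D i * w 2 i)"
      unfolding sum w(1)[OF n(1)] w(1)[OF jk(1)] w(1)[OF jk(2)] w(2)[OF n(1)] w(2)[OF jk(1)] w(2)[OF jk(2)]
        basis[of p, symmetric]
      by (simp add: algebra_simps)
    then show ?thesis by (simp add: D_w algebra_simps)
  qed
  define G where "G i = (if i = 0 then D n else h)" for i :: nat
  \<comment> \<open>Expanding \<open>w 0\<close> in this basis turns its product with
    \<open>D\<close>, which is \<open>h * v 0\<close>, into the relation
    \<open>(\<alpha> (w 0), \<mu>)\<close> between \<open>D n\<close> and \<open>h\<close>.\<close>
  define \<mu> where "\<mu> = \<beta> (w 0) * v 1 + \<gamma> (w 0) * v 2 - v 0"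
  define M where "M i l = (if i = 0 then \<alpha> (w 0) else \<mu>)" for i l :: nat
  have GS: "(\<Sum>i<2. G i * x i) = D n * x 0 + h * x 1" for x
    by (simp add: G_def eval_nat_numeral One_nat_def)
  have d2: "d2 = d - 1" using d12 d1 by simp
  have hom_\<beta>: "homogeneous (d - 2) (\<beta> (w 0))" "homogeneous (d - 2) (\<gamma> (w 0))"
    unfolding \<beta>_def \<gamma>_def \<delta>_def using hom_w(1)[OF jk(1)] hom_w(1)[OF jk(2)] d2
    by (auto intro!: homogeneous_mult_Cst homogeneous_diff)
  have hom_\<alpha>: "homogeneous (d - 2) (\<alpha> (w 0))"
    unfolding \<alpha>_def using hom_w(1)[OF n(1)] hom_\<beta> d2
    by (auto intro!: homogeneous_mult_Cst homogeneous_diff)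
  have hom_\<mu>: "homogeneous (d - 1) \<mu>"
    unfolding \<mu>_def using hom_v hom_\<beta> d2 d1
    by (auto intro!: homogeneous_mult[of "d - 2" _ 1] homogeneous_diff homogeneous_add)
  have "\<mu> \<noteq> 0"
  proof
    assume "\<mu> = 0"
    then have "v 0 = v 1 * \<beta> (w 0) + v 2 * \<gamma> (w 0)" by (simp add: \<mu>_def mult.commute)
    then show False using v0_not_in_ideal unfolding in_ideal2_def by blast
  qed
  let ?F1 = "[d - 1, d - 2]" and ?F2 = "[2 * d - 3]"
  show ?thesis
  proof (rule minimal_resolution_form_2I[where n = 2 and m = 1 and G = G and M = M])
    show "length ?F1 = 2" "length ?F2 = 1" by simp_all
    show "homogeneous (?F1 ! i) (G i) \<and> G i \<in> irrelevant_ideal" if "i < 2" for i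
    proof -
      have "i = 0 \<or> i = 1" using that by linarith
      then have "homogeneous (?F1 ! i) (G i) \<and> 1 \<le> ?F1 ! i"
        using hom_D[OF n(1)] hom_h d d1 by (auto simp: G_def nth_Cons')
      then show ?thesis using homogeneous_in_irrelevant_ideal by blast
    qed
    show "homogeneous (?F2 ! l - ?F1 ! i) (M i l) \<and> M i l \<in> irrelevant_ideal" if il: "i < 2" "l < 1" for i l
    proof -
      have il': "i = 0 \<or> i = 1" "l = 0" using il by linarith+
      have e: "2 * d - 3 - (d - 1) = d - 2" "2 * d - 3 - (d - 2) = d - 1" by simp_all
      have "homogeneous (?F2 ! l - ?F1 ! i) (M i l) \<and> 1 \<le> ?F2 ! l - ?F1 ! i"
        using il' hom_\<alpha> hom_\<mu> d by (auto simp: M_def nth_Cons' e)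
      then show ?thesis using homogeneous_in_irrelevant_ideal by blast
    qed
    show "p \<in> saturation J \<longleftrightarrow> (\<exists>x. p = (\<Sum>i<2. G i * x i))" for p
    proof
      assume "p \<in> saturation J"
      then obtain x u where "p = (\<Sum>i<3. D i * x i) + u * h" unfolding saturation_J[OF J] by (elim exE)
      then have "p = D n * \<alpha> x + h * (\<beta> x * v 1 + \<gamma> x * v 2 + u)"
        unfolding D_basis by (simp add: algebra_simps)
      then have "p = (\<Sum>i<2. G i * (if i = 0 then \<alpha> x else \<beta> x * v 1 + \<gamma> x * v 2 + u))"
        unfolding GS by simp
      then show "\<exists>x. p = (\<Sum>i<2. G i * x i)" by (intro exI)
    next
      assume "\<exists>x. p = (\<Sum>i<2. G i * x i)"
      then obtain x where "p = (\<Sum>i<2. G i * x i)" ..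
      then have "p = D n * x 0 + h * x 1" by (simp only: GS)
      then have "p = (\<Sum>i<3. D i * (if i = n then x 0 else 0)) + x 1 * h"
        unfolding sum using n by (simp add: mult.commute)
      then show "p \<in> saturation J" unfolding saturation_J[OF J] by (intro exI)
    qed
    show "(\<Sum>i<2. G i * M i l) = 0" for l
    proof -
      have "D n * \<alpha> (w 0) + h * (\<beta> (w 0) * v 1 + \<gamma> (w 0) * v 2) = h * v 0"
        using D_basis[of "w 0"] D_w[of 0] by simp
      then show ?thesis unfolding GS by (simp add: M_def \<mu>_def algebra_simps)
    qed
    show "\<exists>c. \<forall>i<2. x i = (\<Sum>l<1. M i l * c l)" if x: "(\<Sum>i<2. G i * x i) = 0" for x
    proof -
      \<comment> \<open>A relation between \<open>D n\<close> and \<open>h\<close> is a relation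
        between \<open>D\<close> and \<open>h\<close> whose entries at \<open>j\<close> and
        \<open>k\<close> vanish.\<close>
      let ?p = "\<lambda>i. if i = n then x 0 else 0"
      have "(\<Sum>i<3. D i * ?p i) + x 1 * h = 0"
        unfolding sum using n x[unfolded GS] by (simp add: mult.commute)
      from kernel[OF this] obtain c where c: "\<And>i. i < 3 \<Longrightarrow> ?p i = (\<Sum>l<3. c l * w l i)"
        "x 1 = - (\<Sum>l<3. c l * v l)"
        by blast
      \<comment> \<open>\<open>B\<close> and \<open>C\<close> are the coordinates of
        \<open>?p\<close> along \<open>w 1\<close> and \<open>w 2\<close>. The vanishing entries at
        \<open>j\<close> and \<open>k\<close> force both to be zero, so \<open>c 0\<close>
        determines the relation.\<close>
      define B where "B = c 0 * \<beta> (w 0) + c 1"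
      define C where "C = c 0 * \<gamma> (w 0) + c 2"
      have cj: "?p j = B * Cst (a j) + C * Cst (b j)"
        unfolding c(1)[OF jk(1)] B_def C_def sum_lessThan_3 w(1)[OF jk(1)] w(2)[OF jk(1)] basis(1)[of "w 0", symmetric]
        by (simp add: algebra_simps)
      have ck: "?p k = B * Cst (a k) + C * Cst (b k)"
        unfolding c(1)[OF jk(2)] B_def C_def sum_lessThan_3 w(1)[OF jk(2)] w(2)[OF jk(2)] basis(2)[of "w 0", symmetric]
        by (simp add: algebra_simps)
      have cn: "?p n = c 0 * \<alpha> (w 0) + B * Cst (a n) + C * Cst (b n)"
        unfolding c(1)[OF n(1)] B_def C_def sum_lessThan_3 w(1)[OF n(1)] w(2)[OF n(1)] basis(3)[of "w 0", symmetric]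
        by (simp add: algebra_simps)
      have BC: "B * Cst (a j) + C * Cst (b j) = 0" "B * Cst (a k) + C * Cst (b k) = 0"
        using cj ck n by simp_all
      have "B * ((Cst (a j) * Cst (b k) - Cst (a k) * Cst (b j)) * \<delta>)
          = ((B * Cst (a j) + C * Cst (b j)) * Cst (b k) - (B * Cst (a k) + C * Cst (b k)) * Cst (b j)) * \<delta>"
        by (simp add: algebra_simps)
      then have B: "B = 0" unfolding BC \<delta> by simp
      have "C * ((Cst (a j) * Cst (b k) - Cst (a k) * Cst (b j)) * \<delta>)
          = ((B * Cst (a k) + C * Cst (b k)) * Cst (a j) - (B * Cst (a j) + C * Cst (b j)) * Cst (a k)) * \<delta>"
        by (simp add: algebra_simps)
      then have C: "C = 0" unfolding BC \<delta> by simp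
      have c12: "c 1 = - (c 0 * \<beta> (w 0))" "c 2 = - (c 0 * \<gamma> (w 0))"
        using B C by (simp_all add: B_def C_def eq_neg_iff_add_eq_0 add.commute)
      have "x 0 = \<alpha> (w 0) * c 0" using cn by (simp add: B C mult.commute)
      moreover have "x 1 = \<mu> * c 0"
        unfolding c(2) sum_lessThan_3 c12 \<mu>_def by (simp add: algebra_simps)
      ultimately have "\<forall>i<2. x i = (\<Sum>l<1. M i l * c l)"
        by (auto simp: M_def less_Suc_eq numeral_2_eq_2 One_nat_def)
      then show ?thesis by (intro exI)
    qed
    show "c l = 0" if z: "\<And>i. i < 2 \<Longrightarrow> (\<Sum>l<1. M i l * c l) = 0" and l: "l < 1" for c l
    proof -
      have "\<mu> * c 0 = 0" using z[of 1] by (simp add: M_def One_nat_def)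
      with \<open>\<mu> \<noteq> 0\<close> l show ?thesis by simp
    qed
  qed
qed

end

section \<open>Reading the given resolution as equations and comparing twists\<close>

theorem theorem1p2:
  fixes f :: S and d :: nat and d1 d2 T \<sigma> s :: int
  assumes "reduced_curve f d"
    and "d \<ge> 3"
    and "nearly_free f"
    and "exponents f d d1 d2"
    and "T = 3 * int d - 6"
    and "\<sigma> = int (sigma_C f)"
    and "s = \<sigma> - (int d - 2)"
  shows "(s = 0 \<and>
          minimal_resolution_form (saturated_jacobian_ideal f)
            [[int d - 1, \<sigma>],
             [T + 1 - \<sigma>]])
       \<or> (1 \<le> s \<and> s \<le> \<lfloor>real d / 2\<rfloor> - 1 \<and>
          minimal_resolution_form (saturated_jacobian_ideal f)
            [[int d - 1, int d - 1, int d - 1, \<sigma>],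
             [\<sigma> + 1, \<sigma> + 1, T + 1 - \<sigma>]])"
proof -
  let ?J = "jacobian_ideal f"
  let ?F1 = "[int d - 1, int d - 1, int d - 1]"
  let ?F2 = "[int d + d1 - 1, int d + d2 - 1, int d + d2 - 1]"
  let ?F3 = "[int d + d2]"
  obtain As where As: "minimal_free_resolution ?J [?F1, ?F2, ?F3] As" and d12: "d1 \<le> d2" "d1 + d2 = int d"
    using assms(4) unfolding exponents_def by blast
  have "length As = 3" using As by (simp add: minimal_free_resolution_def)
  then obtain A B C where "As = [A, B, C]"
    by (auto simp: numeral_3_eq_3 length_Suc_conv)
  with As have R: "minimal_free_resolution ?J [?F1, ?F2, ?F3] [A, B, C]" by simp
  have "length ?F1 = 3" "length ?F2 = 3" "length ?F3 = 1" by simp_all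
  note R = minimal_free_resolution_3D[OF R this]
  define D where "D i = A $$ (0, i)" for i
  \<comment> \<open>The column index comes first, so \<open>r k\<close> is the \<open>k\<close>-th
    relation between the partial derivatives.\<close>
  define r where "r k i = B $$ (i, k)" for k i
  define v where "v k = C $$ (k, 0)" for k
  have J: "p \<in> ?J \<longleftrightarrow> (\<exists>x. p = (\<Sum>i<3. D i * x i))" for p
    using R(4) by (simp add: D_def)
  have ex: "exact_complex D r v"
  proof
    fix p assume "(\<Sum>i<3. D i * p i) = 0"
    then obtain c where "\<forall>i<3. p i = (\<Sum>j<3. B $$ (i, j) * c j)" unfolding D_def R(5) by (elim exE)
    then have "\<forall>i<3. p i = (\<Sum>k<3. c k * r k i)" by (simp add: r_def mult.commute)
    then show "\<exists>c. \<forall>i<3. p i = (\<Sum>k<3. c k * r k i)" by (intro exI)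
  next
    fix k :: nat assume k: "k < 3"
    \<comment> \<open>The unit vector at \<open>k\<close> exhibits the \<open>k\<close>-th column as
      an element of the image of \<open>B\<close>.\<close>
    have "\<forall>i<3. r k i = (\<Sum>j<3. B $$ (i, j) * (if j = k then 1 else 0))"
      using k by (simp add: r_def if_distrib[of "\<lambda>x. _ * x"] sum.delta cong: if_cong)
    then show "(\<Sum>i<3. D i * r k i) = 0" unfolding D_def R(5) by (intro exI)
  next
    have "\<forall>i<3. v i = (\<Sum>j<1. C $$ (i, j) * 1)" by (simp add: v_def sum_lessThan_1)
    then have "\<forall>i<3. (\<Sum>j<3. B $$ (i, j) * v j) = 0" unfolding R(6) by (intro exI)
    then show "(\<Sum>k<3. v k * r k i) = 0" if "i < 3" for i using that by (simp add: r_def mult.commute)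
  next
    fix c assume c: "\<And>i. i < 3 \<Longrightarrow> (\<Sum>k<3. c k * r k i) = 0"
    have "\<forall>i<3. (\<Sum>j<3. B $$ (i, j) * c j) = 0" using c by (simp add: r_def mult.commute)
    then obtain t where "\<forall>i<3. c i = (\<Sum>j<1. C $$ (i, j) * t j)" unfolding R(6) by (elim exE)
    then have "\<forall>k<3. c k = t 0 * v k" by (simp add: v_def sum_lessThan_1 mult.commute)
    then show "\<exists>t. \<forall>k<3. c k = t * v k" by (intro exI)
  next
    show "\<exists>k<3. v k \<noteq> 0"
    proof (rule ccontr)
      assume "\<not> ?thesis"
      \<comment> \<open>A zero column would have the constant \<open>1\<close> in its kernel,
        against injectivity of the last map.\<close>
      then have "\<forall>i<3. (\<Sum>j<1. C $$ (i, j) * 1) = 0" by (simp add: v_def sum_lessThan_1)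
      from R(7)[OF this, rule_format, of 0] show False by simp
    qed
  qed
  interpret nearly_free_complex "int d" d1 d2 D r v
  proof (rule nearly_free_complex.intro)
    show "3 \<le> int d" using assms(2) by simp
    show "exact_complex D r v" by (rule ex)
    show "homogeneous (int d - 1) (D i)" if "i < 3" for i
      using R(1)[OF that] less_3_cases[OF that] by (auto simp: D_def nth_Cons')
    show "homogeneous (d2 - d1 + 1) (v 0)"
      using R(3)[of 0 0] by (simp add: v_def algebra_simps)
    show "homogeneous 1 (v 1)" "homogeneous 1 (v 2)"
      using R(3)[of 1 0] R(3)[of 2 0] by (simp_all add: v_def nth_Cons')
    have B: "homogeneous (?F2 ! k - (int d - 1)) (r k i) \<and> r k i \<in> irrelevant_ideal" if "k < 3" "i < 3" for k i
      using R(2)[OF that(2,1)] less_3_cases[OF that(2)] by (auto simp: r_def nth_Cons')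
    show "homogeneous d1 (r 0 i)" "homogeneous d2 (r 1 i)" "homogeneous d2 (r 2 i)" "r 0 i \<in> irrelevant_ideal"
      if "i < 3" for i
      using B[OF _ that, of 0] B[OF _ that, of 1] B[OF _ that, of 2] by (simp_all add: nth_Cons')
  qed (use d12 in auto)
  obtain w h where "mapping_cone D r v w h" and hom:
    "\<And>i. i < 3 \<Longrightarrow> homogeneous (d2 - 1) (w 0 i)"
    "\<And>i. i < 3 \<Longrightarrow> homogeneous (d1 - 1) (w 1 i)"
    "\<And>i. i < 3 \<Longrightarrow> homogeneous (d1 - 1) (w 2 i)"
    "homogeneous (int d + d1 - 3) h"
    using homogeneous_cone by blast
  interpret mapping_cone D r v w h by fact
  interpret nearly_free_cone "int d" d1 d2 D r v w h
    by unfold_locales (use hom in auto)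
  have \<sigma>: "\<sigma> = int d + d1 - 3" using sigma_C_eq[OF J] assms(6) by simp
  have s: "s = d1 - 1" using assms(7) \<sigma> by simp
  have T: "T + 1 - \<sigma> = int d + d2 - 2" using assms(5) \<sigma> d12 by simp
  show ?thesis
  proof (cases "d1 = 1")
    case True
    \<comment> \<open>Here \<open>d2 = d - 1\<close>, which turns the twist
      \<open>d + d2 - 2\<close> into \<open>2 * d - 3\<close>.\<close>
    have eq: "2 * int d - 3 = T + 1 - \<sigma>" "int d - 2 = \<sigma>" using True T \<sigma> d12 by simp_all
    have "s = 0" using True s by simp
    with resolution_complete_intersection[OF J True] show ?thesis
      unfolding saturated_jacobian_ideal_def eq by blast
  next
    case False
    then have d1: "2 \<le> d1" using d1_pos by simp
    \<comment> \<open>As \<open>s = d1 - 1\<close>, the upper bound on \<open>s\<close> says that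
      the smaller exponent is at most half of \<open>d\<close>.\<close>
    have "real_of_int d1 \<le> real d / 2"
    proof -
      have "2 * d1 \<le> int d" using d12 by simp
      then show ?thesis by linarith
    qed
    then have "d1 \<le> \<lfloor>real d / 2\<rfloor>" by (simp add: le_floor_iff)
    then have "1 \<le> s" "s \<le> \<lfloor>real d / 2\<rfloor> - 1" using d1 s by simp_all
    moreover have eq: "int d + d1 - 3 = \<sigma>" "int d + d1 - 2 = \<sigma> + 1" "int d + d2 - 2 = T + 1 - \<sigma>"
      using \<sigma> T by simp_all
    ultimately show ?thesis
      using resolution_general[OF J d1] unfolding saturated_jacobian_ideal_def eq by blast
  qed
qed

end
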